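(* Let $A>0$, and let $\alpha,\beta\in\mathbb{R}$ satisfy $\alpha\le\beta\le 1$, $\beta>0$, $\alpha<1$. Let $a_{i,j}=A(i^\alpha j^\beta+i^\beta j^\alpha)$ for $i,j\ge1$, and let $(B_{j,k}^i)$ be a daughter distribution function satisfying conditions (B1), (B2), (B3) of the context. Let $F_m$ and $\mu_m$, $m>1$, be the constants fixed in the context. Given $w^{\rm in}\in Y_1^+\cap Y_{1+\beta}$, there is a unique mass-conserving solution $w=\Psi(\cdot;w^{\rm in})$ on $[0,+\infty)$ to the discrete collision-induced breakage equation with initial condition $w^{\rm in}$ such that $w\in L^\infty((0,+\infty),Y_{1+\beta})$ and $w$ satisfies properties (P1), (P2) and (P3) of the context. In addition, given $0<\rho_0\le\rho_1$ and $R\ge\mu_{1+\beta}$ (where $\mu_{1+\beta}=\mu_{1+\beta}(\rho_0,\rho_1)$), $\Psi$ is a dynamical system in $$\mathcal{S}(\rho_0,\rho_1,R):=\big\{y\in Y_1^+:\ \rho_0\le M_0(y)\le M_1(y)=\rho_1\ \text{ and }\ M_{1+\beta}(y)\le R\big\}$$ for the topology induced by the norm of $Y_1$.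
   Context: Spaces and moments. For $\gamma\ge0$, $Y_\gamma$ is the Banach space of real sequences $y=(y_i)_{i\ge1}$ with $\|y\|_\gamma=\sum_{i\ge1}i^\gamma|y_i|<\infty$, and $Y_\gamma^+=\{y\in Y_\gamma: y_i\ge0 \text{ for all } i\ge 1\}$. For a non-negative sequence $w$, $M_\gamma(w)=\sum_{i\ge1}i^\gamma w_i$. Equation. The discrete collision-induced breakage equation with initial condition $w^{\rm in}$ is, for $i\ge1$, $$\frac{dw_i}{dt}=\frac12\sum_{j=i+1}^\infty\sum_{k=1}^{j-1}B_{j-k,k}^i\,a_{j-k,k}\,w_{j-k}w_k-\sum_{j=1}^\infty a_{i,j}w_iw_j,\qquad w_i(0)=w_i^{\rm in}.$$ Conditions on the daughter distribution function $(B_{i,j}^s)$, $i,j,s\ge1$: (B1) for all $i,j\ge1$: $B_{i,j}^s=B_{j,i}^s\ge0$ for $1\le s\le i+j-1$, $B_{i,j}^s=0$ for $s\ge i+j$, and $\sum_{s=1}^{i+j-1}sB_{i,j}^s=i+j$; (B2) for each $m>1$ there are constants $\epsilon_m\in(0,1)$ and $\kappa_m\ge1$ such that, for all $j,k\ge1$, $\sum_{i=1}^{j+k-1}i^mB_{j,k}^i\le(1-\epsilon_m)(j^m+k^m)+\kappa_m(jk^{m-1}+j^{m-1}k)$; (B3) $\sum_{i=1}^{j+k-1}B_{j,k}^i\ge2$ for all $j,k\ge1$. Solutions. Let $T\in(0,+\infty]$ and $w^{\rm in}\in Y_1^+$. A solution on $[0,T)$ with initial condition $w^{\rm in}$ is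 a sequence $w=(w_i)_{i\ge1}$ of non-negative continuous functions such that, for each $i\ge1$ and $t\in(0,T)$: $w_i\in C([0,t))$, $\sum_{j}a_{i,j}w_j\in L^1(0,t)$, $\sum_{j=i+1}^\infty\sum_{k=1}^{j-1}B_{j-k,k}^ia_{j-k,k}w_{j-k}w_k\in L^1(0,t)$, and $$w_i(t)=w_i^{\rm in}+\int_0^t\Big(\frac12\sum_{j=i+1}^\infty\sum_{k=1}^{j-1}B_{j-k,k}^ia_{j-k,k}w_{j-k}(\tau)w_k(\tau)-\sum_{j=1}^\infty a_{i,j}w_i(\tau)w_j(\tau)\Big)d\tau.$$ It is mass-conserving on $[0,T)$ if $M_1(w(t))=M_1(w^{\rm in})$ for all $t\in[0,T)$. The constants $F_m$, $\mu_m$ and properties (P1)–(P3). Let $A>0$, let $\alpha,\beta\in\mathbb{R}$ satisfy $\alpha\le\beta\le1$, $\beta>0$, $\alpha<1$, let $a_{i,j}=A(i^\alpha j^\beta+i^\beta j^\alpha)$ for $i,j\ge1$, and let $(B_{j,k}^i)$ satisfy (B1), (B2) and (B3). It is known that there then exist, for every $m>1$, a constant $F_m>0$ depending only on $m,A,\alpha,\beta,\epsilon_m,\kappa_m,M_1(w^{\rm in}),M_0(w^{\rm in})$, and, for every $m>1$ and $\rho_1\ge\rho_0>0$, a constant $\mu_m=\mu_m(\rho_0,\rho_1)>0$ depending only on $m,A,\alpha,\beta,\epsilon_m,\kappa_m,\rho_1,\rho_0$, such that for every $w^{\rm in}\in Y_1^+$ there is at least one mass-conserving solution $w$ on $[0,+\infty)$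 with initial condition $w^{\rm in}$ satisfying: (P1) $M_0(w(t))\ge M_0(w^{\rm in})$ for $t\ge0$; (P2) for any $m>1$ and $t>0$, $w(t)\in Y_m$ and $M_m(w(t))\le F_m(1+1/t)^{(m-1)/\beta}$; (P3) for every $m>1$ and $\rho_1\ge\rho_0>0$, if $w^{\rm in}\in Y_m$, $M_1(w^{\rm in})\le\rho_1$ and $M_0(w^{\rm in})\ge\rho_0$, then $M_m(w(t))\le\max\{M_m(w^{\rm in}),\mu_m(\rho_0,\rho_1)\}$ for $t>0$. Such constants are fixed. Dynamical system. A dynamical system in a subset $\mathcal{S}$ of a Banach space (with the induced topology) is a continuous map $\Psi:[0,+\infty)\times\mathcal{S}\to\mathcal{S}$ with $\Psi(0;y)=y$ and $\Psi(t+s;y)=\Psi(t;\Psi(s;y))$ for all $t,s\ge0$ and $y\in\mathcal{S}$. *)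

theory Defs
  imports "HOL-Analysis.Analysis"
begin

text \<open>A real sequence \<open>(y_i)\<close>, \<open>i \<ge> 1\<close>, is encoded as a function on \<^typ>\<open>nat\<close> that vanishes
  at the unused index \<open>0\<close>. Thus equality of functions is equality of sequences, and the norms
  below separate points.\<close>

definition Y :: "real \<Rightarrow> (nat \<Rightarrow> real) set" where
  "Y \<gamma> = {y. y 0 = 0 \<and> (\<lambda>i. real i powr \<gamma> * \<bar>y i\<bar>) summable_on {1..}}"

definition normY :: "real \<Rightarrow> (nat \<Rightarrow> real) \<Rightarrow> real" where
  "normY \<gamma> y = (\<Sum>\<^sub>\<infinity>i\<in>{1..}. real i powr \<gamma> * \<bar>y i\<bar>)"

definition Ypos :: "real \<Rightarrow> (nat \<Rightarrow> real) set" where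
  "Ypos \<gamma> = {y \<in> Y \<gamma>. \<forall>i\<ge>1. 0 \<le> y i}"

text \<open>Moments take values in \<open>[0,\<infinity>]\<close>, so that a bound by a finite number includes convergence of
  the series. They are used for non-negative sequences only.\<close>

definition M :: "real \<Rightarrow> (nat \<Rightarrow> real) \<Rightarrow> ennreal" where
  "M \<gamma> w = (\<Sum>\<^sub>\<infinity>i\<in>{1..}. ennreal (real i powr \<gamma> * w i))"

definition distY :: "real \<Rightarrow> (nat \<Rightarrow> real) \<Rightarrow> (nat \<Rightarrow> real) \<Rightarrow> real" where
  "distY \<gamma> y z = normY \<gamma> (\<lambda>i. y i - z i)"

definition topY :: "real \<Rightarrow> (nat \<Rightarrow> real) topology" where
  "topY \<gamma> = Metric_space.mtopology (Y \<gamma>) (distY \<gamma>)"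

lemma Y_diff:
  assumes "y \<in> Y \<gamma>" "z \<in> Y \<gamma>"
  shows "(\<lambda>i. y i - z i) \<in> Y \<gamma>"
proof -
  have "(\<lambda>i. real i powr \<gamma> * \<bar>y i\<bar> + real i powr \<gamma> * \<bar>z i\<bar>) summable_on {1..}"
    using assms by (intro summable_on_add) (auto simp: Y_def)
  then have "(\<lambda>i. real i powr \<gamma> * \<bar>y i - z i\<bar>) summable_on {1..}"
    by (rule summable_on_comparison_test)
      (auto simp flip: distrib_left intro!: mult_left_mono)
  then show ?thesis using assms by (auto simp: Y_def)
qed

lemma Metric_space_Y: "Metric_space (Y \<gamma>) (distY \<gamma>)"
proof
  fix x y z
  show "0 \<le> distY \<gamma> x y"
    by (auto simp: distY_def normY_def intro!: infsum_nonneg)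
  show "distY \<gamma> x y = distY \<gamma> y x"
    by (simp add: distY_def normY_def abs_minus_commute)
  assume x: "x \<in> Y \<gamma>" and y: "y \<in> Y \<gamma>"
  have sxy: "(\<lambda>i. real i powr \<gamma> * \<bar>x i - y i\<bar>) summable_on {1..}"
    using Y_diff[OF x y] by (auto simp: Y_def)
  show "(distY \<gamma> x y = 0) = (x = y)"
  proof
    assume d: "distY \<gamma> x y = 0"
    have eq: "x i = y i" if "i \<ge> 1" for i
    proof -
      have "real i powr \<gamma> * \<bar>x i - y i\<bar> = 0"
        using d sxy that
        by (intro nonneg_infsum_le_0D[where A = "{1..}" and f = "\<lambda>i. real i powr \<gamma> * \<bar>x i - y i\<bar>"])
          (auto simp: distY_def normY_def)
      with that show ?thesis by simp
    qed
    show "x = y"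
    proof
      fix i show "x i = y i"
        using eq[of i] x y by (cases i) (auto simp: Y_def)
    qed
  qed (simp add: distY_def normY_def)
  assume z: "z \<in> Y \<gamma>"
  have syz: "(\<lambda>i. real i powr \<gamma> * \<bar>y i - z i\<bar>) summable_on {1..}"
    using Y_diff[OF y z] by (auto simp: Y_def)
  have sxz: "(\<lambda>i. real i powr \<gamma> * \<bar>x i - z i\<bar>) summable_on {1..}"
    using Y_diff[OF x z] by (auto simp: Y_def)
  have "distY \<gamma> x z \<le> (\<Sum>\<^sub>\<infinity>i\<in>{1..}. real i powr \<gamma> * \<bar>x i - y i\<bar> + real i powr \<gamma> * \<bar>y i - z i\<bar>)"
    unfolding distY_def normY_def
    by (intro infsum_mono sxz summable_on_add sxy syz)
      (auto simp flip: distrib_left intro!: mult_left_mono)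
  also have "\<dots> = distY \<gamma> x y + distY \<gamma> y z"
    unfolding distY_def normY_def by (intro infsum_add sxy syz)
  finally show "distY \<gamma> x z \<le> distY \<gamma> x y + distY \<gamma> y z" .
qed

text \<open>Membership in \<open>L^1(0,t)\<close> of a non-negative function that may take the value \<open>\<infinity>\<close>.\<close>

definition in_L1 :: "real \<Rightarrow> (real \<Rightarrow> ennreal) \<Rightarrow> bool" where
  "in_L1 t f \<longleftrightarrow> f \<in> borel_measurable (lebesgue_on {0<..<t}) \<and>
     (\<integral>\<^sup>+\<tau>. f \<tau> \<partial>lebesgue_on {0<..<t}) < \<infinity>"

text \<open>Strong (Bochner) measurability: almost everywhere norm limit of simple functions.\<close>

definition strongly_measurable_Y :: "real \<Rightarrow> real set \<Rightarrow> (real \<Rightarrow> nat \<Rightarrow> real) \<Rightarrow> bool" where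
  "strongly_measurable_Y \<gamma> I w \<longleftrightarrow>
     (\<exists>s. (\<forall>n. simple_function (lebesgue_on I) (s n) \<and> s n ` I \<subseteq> Y \<gamma>) \<and>
       (AE t in lebesgue_on I. w t \<in> Y \<gamma> \<and> (\<lambda>n. distY \<gamma> (s n t) (w t)) \<longlonglongrightarrow> 0))"

definition in_Linfty_Y :: "real \<Rightarrow> real set \<Rightarrow> (real \<Rightarrow> nat \<Rightarrow> real) \<Rightarrow> bool" where
  "in_Linfty_Y \<gamma> I w \<longleftrightarrow> strongly_measurable_Y \<gamma> I w \<and>
     (\<exists>C. AE t in lebesgue_on I. w t \<in> Y \<gamma> \<and> normY \<gamma> (w t) \<le> C)"

definition coll_kernel :: "real \<Rightarrow> real \<Rightarrow> real \<Rightarrow> nat \<Rightarrow> nat \<Rightarrow> real" where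
  "coll_kernel A \<alpha> \<beta> i j =
     A * (real i powr \<alpha> * real j powr \<beta> + real i powr \<beta> * real j powr \<alpha>)"

text \<open>\<open>B i j s\<close> stands for \<open>B_{i,j}^s\<close>; only the values at positive indices matter.\<close>

definition cond_B1 :: "(nat \<Rightarrow> nat \<Rightarrow> nat \<Rightarrow> real) \<Rightarrow> bool" where
  "cond_B1 B \<longleftrightarrow> (\<forall>i\<ge>1. \<forall>j\<ge>1.
     (\<forall>s\<in>{1..i+j-1}. B i j s = B j i s \<and> 0 \<le> B i j s) \<and>
     (\<forall>s\<ge>i+j. B i j s = 0) \<and>
     (\<Sum>s=1..i+j-1. real s * B i j s) = real (i + j))"

definition cond_B2 :: "(nat \<Rightarrow> nat \<Rightarrow> nat \<Rightarrow> real) \<Rightarrow> bool" where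
  "cond_B2 B \<longleftrightarrow> (\<forall>m::real. m > 1 \<longrightarrow> (\<exists>\<epsilon> \<kappa>. 0 < \<epsilon> \<and> \<epsilon> < 1 \<and> 1 \<le> \<kappa> \<and>
     (\<forall>j\<ge>1. \<forall>k\<ge>1. (\<Sum>i=1..j+k-1. real i powr m * B j k i)
        \<le> (1 - \<epsilon>) * (real j powr m + real k powr m)
          + \<kappa> * (real j * real k powr (m - 1) + real j powr (m - 1) * real k))))"

definition cond_B3 :: "(nat \<Rightarrow> nat \<Rightarrow> nat \<Rightarrow> real) \<Rightarrow> bool" where
  "cond_B3 B \<longleftrightarrow> (\<forall>j\<ge>1. \<forall>k\<ge>1. 2 \<le> (\<Sum>i=1..j+k-1. B j k i))"

text \<open>The two series of the equation (the first without its factor \<open>1/2\<close>) and the series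
  \<open>\<Sum>_j a_{i,j} y_j\<close>, all with non-negative terms and with values in \<open>[0,\<infinity>]\<close>.\<close>

definition gain ::
    "(nat \<Rightarrow> nat \<Rightarrow> real) \<Rightarrow> (nat \<Rightarrow> nat \<Rightarrow> nat \<Rightarrow> real) \<Rightarrow> nat \<Rightarrow> (nat \<Rightarrow> real) \<Rightarrow> ennreal" where
  "gain a B i y =
     (\<Sum>\<^sub>\<infinity>j\<in>{i+1..}. \<Sum>k=1..j-1. ennreal (B (j-k) k i * a (j-k) k * y (j-k) * y k))"

definition loss :: "(nat \<Rightarrow> nat \<Rightarrow> real) \<Rightarrow> nat \<Rightarrow> (nat \<Rightarrow> real) \<Rightarrow> ennreal" where
  "loss a i y = (\<Sum>\<^sub>\<infinity>j\<in>{1..}. ennreal (a i j * y i * y j))"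

definition coll_rate :: "(nat \<Rightarrow> nat \<Rightarrow> real) \<Rightarrow> nat \<Rightarrow> (nat \<Rightarrow> real) \<Rightarrow> ennreal" where
  "coll_rate a i y = (\<Sum>\<^sub>\<infinity>j\<in>{1..}. ennreal (a i j * y j))"

text \<open>In the integral equation \<^const>\<open>enn2real\<close> is harmless: by the two integrability conditions
  the series are finite for almost every \<open>\<tau>\<close>. The condition at index \<open>0\<close> belongs to the encoding of
  sequences.\<close>

definition cib_solution ::
    "(nat \<Rightarrow> nat \<Rightarrow> real) \<Rightarrow> (nat \<Rightarrow> nat \<Rightarrow> nat \<Rightarrow> real) \<Rightarrow> ereal \<Rightarrow> (nat \<Rightarrow> real) \<Rightarrow>
      (real \<Rightarrow> nat \<Rightarrow> real) \<Rightarrow> bool" where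
  "cib_solution a B T win w \<longleftrightarrow> 0 < T \<and> win \<in> Ypos 1 \<and>
     (\<forall>t. 0 \<le> t \<and> ereal t < T \<longrightarrow> w t 0 = 0 \<and> (\<forall>i\<ge>1. 0 \<le> w t i)) \<and>
     (\<forall>i\<ge>1. \<forall>t. 0 < t \<and> ereal t < T \<longrightarrow>
        continuous_on {0..<t} (\<lambda>\<tau>. w \<tau> i) \<and>
        in_L1 t (\<lambda>\<tau>. coll_rate a i (w \<tau>)) \<and>
        in_L1 t (\<lambda>\<tau>. gain a B i (w \<tau>)) \<and>
        w t i = win i + (LINT \<tau>|lebesgue_on {0<..<t}.
          1/2 * enn2real (gain a B i (w \<tau>)) - enn2real (loss a i (w \<tau>))))"

definition mass_conserving_solution ::
    "(nat \<Rightarrow> nat \<Rightarrow> real) \<Rightarrow> (nat \<Rightarrow> nat \<Rightarrow> nat \<Rightarrow> real) \<Rightarrow> ereal \<Rightarrow> (nat \<Rightarrow> real) \<Rightarrow>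
      (real \<Rightarrow> nat \<Rightarrow> real) \<Rightarrow> bool" where
  "mass_conserving_solution a B T win w \<longleftrightarrow> cib_solution a B T win w \<and>
     (\<forall>t. 0 \<le> t \<and> ereal t < T \<longrightarrow> M 1 (w t) = M 1 win)"

definition P1 :: "(nat \<Rightarrow> real) \<Rightarrow> (real \<Rightarrow> nat \<Rightarrow> real) \<Rightarrow> bool" where
  "P1 win w \<longleftrightarrow> (\<forall>t\<ge>0. M 0 win \<le> M 0 (w t))"

text \<open>\<open>F m r\<^sub>1 r\<^sub>0\<close> is the constant \<open>F_m\<close> as a function of \<open>r\<^sub>1 = M_1(win)\<close> and \<open>r\<^sub>0 = M_0(win)\<close>;
  \<open>A\<close>, \<open>\<alpha>\<close>, \<open>\<beta>\<close> and the daughter distribution are fixed throughout.\<close>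

definition P2 :: "real \<Rightarrow> (real \<Rightarrow> ennreal \<Rightarrow> ennreal \<Rightarrow> real) \<Rightarrow> (nat \<Rightarrow> real) \<Rightarrow>
    (real \<Rightarrow> nat \<Rightarrow> real) \<Rightarrow> bool" where
  "P2 \<beta> F win w \<longleftrightarrow> (\<forall>m>1. \<forall>t>0. w t \<in> Y m \<and>
     M m (w t) \<le> ennreal (F m (M 1 win) (M 0 win) * (1 + 1/t) powr ((m - 1) / \<beta>)))"

definition P3 :: "(real \<Rightarrow> real \<Rightarrow> real \<Rightarrow> real) \<Rightarrow> (nat \<Rightarrow> real) \<Rightarrow> (real \<Rightarrow> nat \<Rightarrow> real) \<Rightarrow> bool"
  where
  "P3 \<mu> win w \<longleftrightarrow> (\<forall>m>1. \<forall>\<rho>\<^sub>0 \<rho>\<^sub>1. 0 < \<rho>\<^sub>0 \<and> \<rho>\<^sub>0 \<le> \<rho>\<^sub>1 \<longrightarrow>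
     win \<in> Y m \<and> M 1 win \<le> ennreal \<rho>\<^sub>1 \<and> ennreal \<rho>\<^sub>0 \<le> M 0 win \<longrightarrow>
     (\<forall>t>0. M m (w t) \<le> max (M m win) (ennreal (\<mu> m \<rho>\<^sub>0 \<rho>\<^sub>1))))"

text \<open>The defining property of the constants \<open>F_m\<close> and \<open>\<mu>_m\<close>: they are positive, and each
  initial condition admits a mass-conserving solution with (P1)--(P3) for these constants.\<close>

definition moment_constants :: "real \<Rightarrow> real \<Rightarrow> real \<Rightarrow> (nat \<Rightarrow> nat \<Rightarrow> nat \<Rightarrow> real) \<Rightarrow>
    (real \<Rightarrow> ennreal \<Rightarrow> ennreal \<Rightarrow> real) \<Rightarrow> (real \<Rightarrow> real \<Rightarrow> real \<Rightarrow> real) \<Rightarrow> bool" where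
  "moment_constants A \<alpha> \<beta> B F \<mu> \<longleftrightarrow>
     (\<forall>m>1. \<forall>win\<in>Ypos 1. 0 < F m (M 1 win) (M 0 win)) \<and>
     (\<forall>m>1. \<forall>\<rho>\<^sub>0 \<rho>\<^sub>1. 0 < \<rho>\<^sub>0 \<and> \<rho>\<^sub>0 \<le> \<rho>\<^sub>1 \<longrightarrow> 0 < \<mu> m \<rho>\<^sub>0 \<rho>\<^sub>1) \<and>
     (\<forall>win\<in>Ypos 1. \<exists>w. mass_conserving_solution (coll_kernel A \<alpha> \<beta>) B \<infinity> win w \<and>
        P1 win w \<and> P2 \<beta> F win w \<and> P3 \<mu> win w)"

definition bounded_mc_solution :: "real \<Rightarrow> real \<Rightarrow> real \<Rightarrow> (nat \<Rightarrow> nat \<Rightarrow> nat \<Rightarrow> real) \<Rightarrow>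
    (real \<Rightarrow> ennreal \<Rightarrow> ennreal \<Rightarrow> real) \<Rightarrow> (real \<Rightarrow> real \<Rightarrow> real \<Rightarrow> real) \<Rightarrow>
    (nat \<Rightarrow> real) \<Rightarrow> (real \<Rightarrow> nat \<Rightarrow> real) \<Rightarrow> bool" where
  "bounded_mc_solution A \<alpha> \<beta> B F \<mu> win w \<longleftrightarrow>
     mass_conserving_solution (coll_kernel A \<alpha> \<beta>) B \<infinity> win w \<and>
     in_Linfty_Y (1 + \<beta>) {0<..} w \<and> P1 win w \<and> P2 \<beta> F win w \<and> P3 \<mu> win w"

definition dynamical_system :: "'a topology \<Rightarrow> (real \<Rightarrow> 'a \<Rightarrow> 'a) \<Rightarrow> bool" where
  "dynamical_system X \<Psi> \<longleftrightarrow>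
     continuous_map (prod_topology (top_of_set {0..}) X) X (\<lambda>(t, y). \<Psi> t y) \<and>
     (\<forall>y\<in>topspace X. \<Psi> 0 y = y) \<and>
     (\<forall>y\<in>topspace X. \<forall>t\<ge>0. \<forall>s\<ge>0. \<Psi> (t + s) y = \<Psi> t (\<Psi> s y))"

definition S :: "real \<Rightarrow> real \<Rightarrow> real \<Rightarrow> real \<Rightarrow> (nat \<Rightarrow> real) set" where
  "S \<beta> \<rho>\<^sub>0 \<rho>\<^sub>1 R = {y \<in> Ypos 1. ennreal \<rho>\<^sub>0 \<le> M 0 y \<and> M 0 y \<le> M 1 y \<and> M 1 y = ennreal \<rho>\<^sub>1 \<and>
     M (1 + \<beta>) y \<le> ennreal R}"

end

theory Submission
  imports Defs
begin

text \<open>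
  Let \<open>w\<close> and \<open>z\<close> be two solutions whose moments of order \<open>1 + \<beta>\<close> stay below \<open>C\<close>, and put
  \<open>x = w - z\<close>, \<open>s = (w + z) / 2\<close>. Since \<open>w\<^sub>p w\<^sub>k - z\<^sub>p z\<^sub>k = x\<^sub>p s\<^sub>k + s\<^sub>p x\<^sub>k\<close>, the weak form of the
  equation gives formally, with \<open>\<sigma>\<^sub>i = sgn x\<^sub>i\<close>,
  \<open>d/dt \<Sum>\<^sub>i i |x\<^sub>i| = \<Sum>\<^sub>p\<^sub>k a\<^sub>p\<^sub>k x\<^sub>p s\<^sub>k (\<Sum>\<^sub>i i \<sigma>\<^sub>i B\<^sub>p\<^sub>k\<^sup>i - p \<sigma>\<^sub>p - k \<sigma>\<^sub>k)\<close>.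
  The fragments of a collision carry the mass \<open>p + k\<close>, so the term in \<open>p\<close> cancels and
  the right-hand side is at most \<open>2 \<Sum>\<^sub>p\<^sub>k k a\<^sub>p\<^sub>k |x\<^sub>p| s\<^sub>k\<close>. Because \<open>\<alpha> \<le> \<beta> \<le> 1\<close>, the
  weight \<open>k a\<^sub>p\<^sub>k\<close> is at most \<open>2 A p k\<^sup>1\<^sup>+\<^sup>\<beta>\<close>, and Gronwall's inequality yields
  \<open>\<parallel>w(t) - z(t)\<parallel>\<^sub>1 \<le> exp (4 A C t) \<parallel>w(0) - z(0)\<parallel>\<^sub>1\<close>.

  Two points make this rigorous. The cancellation is applied to the finite sum over collisions
  with \<open>p + k \<le> N\<close> (lemma \<open>truncated_rate_difference_le\<close>); the collisions left out contribute
  \<open>O(1/N)\<close> in the norm of \<open>Y\<^sub>1\<close> where the moment of order \<open>2 + \<beta>\<close> is bounded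
  (lemma \<open>net_rate_trunc_error\<close>). By (P2) this is the case on every \<open>[\<delta>, \<infinity>)\<close> with \<open>\<delta> > 0\<close>,
  so \<open>N\<close> is sent to infinity first and \<open>\<delta>\<close> to zero afterwards. And \<open>|x\<^sub>i|\<close> is not differentiated:
  with the signs frozen at the right end point, \<open>|x\<^sub>i(t)| - |x\<^sub>i(s)| \<le> \<sigma>\<^sub>i(t) (x\<^sub>i(t) - x\<^sub>i(s))\<close> for
  \<open>s < t\<close>, which bounds left difference quotients and is enough for a Gronwall argument
  (lemmas \<open>left_Dini_bound\<close> and \<open>distance_growth_truncated\<close>).

  Everything else follows from this stability estimate (lemma \<open>regular_evolution_stability\<close>).
  The bound on the moment of order \<open>1 + \<beta>\<close> comes from (P3), applied with the mass and the number
  of particles of the initial condition. Uniqueness is the case of equal initial data. The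
  semigroup property is uniqueness for a time-shifted solution. The set \<open>S\<close> is invariant by mass
  conservation, (P1) and (P3), all solutions that start in it share the bound \<open>C = R\<close>, and joint
  continuity combines stability with the continuity in time of a single solution, which holds in
  \<open>Y\<^sub>1\<close> because the coordinates are continuous and the tails are uniformly small.
\<close>

section \<open>Moments and norms through partial sums\<close>

lemma ennreal_partial_sums_tendsto:
  fixes f :: "nat \<Rightarrow> ennreal"
  shows "(\<lambda>n. \<Sum>i\<in>I \<inter> {..n}. f i) \<longlonglongrightarrow> (\<Sum>\<^sub>\<infinity>i\<in>I. f i)"
proof -
  have "f summable_on I" by (rule nonneg_summable_on_complete) simp
  then have "(sum f \<longlongrightarrow> infsum f I) (finite_subsets_at_top I)"
    using has_sum_infsum has_sum_def by blast
  moreover have "filterlim (\<lambda>n. I \<inter> {..n}) (finite_subsets_at_top I) sequentially"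
    unfolding filterlim_finite_subsets_at_top
  proof safe
    fix X assume X: "finite X" "X \<subseteq> I"
    then obtain m where "X \<subseteq> {..m}" using finite_nat_set_iff_bounded_le[of X] by auto
    then show "\<forall>\<^sub>F n in sequentially. finite (I \<inter> {..n}) \<and> X \<subseteq> I \<inter> {..n} \<and> I \<inter> {..n} \<subseteq> I"
      using X by (intro eventually_sequentiallyI[of m]) auto
  qed
  ultimately show ?thesis by (rule filterlim_compose)
qed

text \<open>All estimates below are inequalities between finite sums; this equivalence and the next lemmas
translate them to and from moments, norms and membership in \<open>Y \<gamma>\<close>.\<close>

lemma moment_le_iff:
  assumes "\<And>i. i \<ge> 1 \<Longrightarrow> 0 \<le> y i" and "0 \<le> C"
  shows "M \<gamma> y \<le> ennreal C \<longleftrightarrow> (\<forall>n. (\<Sum>i=1..n. real i powr \<gamma> * y i) \<le> C)"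
proof -
  have eq: "(\<Sum>i\<in>{1..} \<inter> {..n}. ennreal (real i powr \<gamma> * y i)) = ennreal (\<Sum>i=1..n. real i powr \<gamma> * y i)" for n
  proof -
    have "{1..} \<inter> {..n} = {1..n}" by auto
    then show ?thesis using assms(1) by (subst sum_ennreal) auto
  qed
  have lim: "(\<lambda>n. ennreal (\<Sum>i=1..n. real i powr \<gamma> * y i)) \<longlonglongrightarrow> M \<gamma> y"
    using ennreal_partial_sums_tendsto[where I = "{1..}" and f = "\<lambda>i. ennreal (real i powr \<gamma> * y i)"]
    unfolding M_def eq .
  have inc: "incseq (\<lambda>n. ennreal (\<Sum>i=1..n. real i powr \<gamma> * y i))"
    using assms(1) by (intro incseq_SucI ennreal_leI) auto
  show ?thesis
  proof
    assume le: "M \<gamma> y \<le> ennreal C"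
    show "\<forall>n. (\<Sum>i=1..n. real i powr \<gamma> * y i) \<le> C"
    proof
      fix n
      have "ennreal (\<Sum>i=1..n. real i powr \<gamma> * y i) \<le> ennreal C"
        using incseq_le[OF inc lim, of n] le by (rule order_trans)
      then show "(\<Sum>i=1..n. real i powr \<gamma> * y i) \<le> C" using \<open>0 \<le> C\<close> by simp
    qed
  next
    assume "\<forall>n. (\<Sum>i=1..n. real i powr \<gamma> * y i) \<le> C"
    then show "M \<gamma> y \<le> ennreal C"
      by (intro LIMSEQ_le_const2[OF lim]) (auto intro: ennreal_leI)
  qed
qed

lemma summable_on_iff_partial_sums_bounded:
  fixes f :: "nat \<Rightarrow> real"
  assumes "\<And>i. i \<ge> 1 \<Longrightarrow> 0 \<le> f i"
  shows "f summable_on {1..} \<longleftrightarrow> (\<exists>C. \<forall>n. (\<Sum>i=1..n. f i) \<le> C)"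
proof
  assume "f summable_on {1..}"
  then show "\<exists>C. \<forall>n. (\<Sum>i=1..n. f i) \<le> C"
    using assms by (intro exI[of _ "infsum f {1..}"] allI finite_sum_le_infsum) simp_all
next
  assume "\<exists>C. \<forall>n. (\<Sum>i=1..n. f i) \<le> C"
  then obtain C where C: "(\<Sum>i=1..n. f i) \<le> C" for n by blast
  show "f summable_on {1..}"
  proof (rule nonneg_bdd_above_summable_on)
    show "bdd_above (sum f ` {F. F \<subseteq> {1..} \<and> finite F})"
    proof (rule bdd_aboveI2)
      fix F assume F: "F \<in> {F. F \<subseteq> {1::nat..} \<and> finite F}"
      then obtain m where "F \<subseteq> {..m}" using finite_nat_set_iff_bounded_le[of F] by auto
      with F have "F \<subseteq> {1..m}" by auto
      then have "sum f F \<le> (\<Sum>i=1..m. f i)" using assms by (intro sum_mono2) auto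
      with C[of m] show "sum f F \<le> C" by linarith
    qed
  qed (use assms in auto)
qed

lemma infsum_le_if_partial_sums_le:
  fixes f :: "nat \<Rightarrow> real"
  assumes "\<And>i. i \<ge> 1 \<Longrightarrow> 0 \<le> f i" and "\<And>n. (\<Sum>i=1..n. f i) \<le> C"
  shows "infsum f {1..} \<le> C"
proof (rule infsum_le_finite_sums)
  show "f summable_on {1..}"
    using summable_on_iff_partial_sums_bounded[of f] assms by metis
  fix F assume F: "finite F" "F \<subseteq> {1::nat..}"
  then obtain m where "F \<subseteq> {..m}" using finite_nat_set_iff_bounded_le[of F] by auto
  with F have "F \<subseteq> {1..m}" by auto
  then have "sum f F \<le> (\<Sum>i=1..m. f i)" using assms(1) by (intro sum_mono2) auto
  with assms(2)[of m] show "sum f F \<le> C" by linarith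
qed

lemma in_Y_iff_moment_finite:
  assumes "y 0 = 0" and "\<And>i. i \<ge> 1 \<Longrightarrow> 0 \<le> y i"
  shows "y \<in> Y \<gamma> \<longleftrightarrow> M \<gamma> y < \<infinity>"
proof -
  have "y \<in> Y \<gamma> \<longleftrightarrow> (\<lambda>i. real i powr \<gamma> * y i) summable_on {1..}"
    using assms summable_on_cong[of "{1..}" "\<lambda>i. real i powr \<gamma> * \<bar>y i\<bar>" "\<lambda>i. real i powr \<gamma> * y i"]
    by (simp add: Y_def)
  also have "\<dots> \<longleftrightarrow> (\<exists>C. \<forall>n. (\<Sum>i=1..n. real i powr \<gamma> * y i) \<le> C)"
    using assms by (intro summable_on_iff_partial_sums_bounded) auto
  also have "\<dots> \<longleftrightarrow> (\<exists>C\<ge>0. M \<gamma> y \<le> ennreal C)"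
  proof
    assume "\<exists>C. \<forall>n. (\<Sum>i=1..n. real i powr \<gamma> * y i) \<le> C"
    then obtain C where C: "(\<Sum>i=1..n. real i powr \<gamma> * y i) \<le> C" for n by blast
    with C[of 0] show "\<exists>C\<ge>0. M \<gamma> y \<le> ennreal C"
      using moment_le_iff[of y C \<gamma>] assms by (intro exI[of _ C]) auto
  next
    assume "\<exists>C\<ge>0. M \<gamma> y \<le> ennreal C"
    then show "\<exists>C. \<forall>n. (\<Sum>i=1..n. real i powr \<gamma> * y i) \<le> C"
      using moment_le_iff[of y _ \<gamma>] assms by blast
  qed
  also have "\<dots> \<longleftrightarrow> M \<gamma> y < \<infinity>"
    by (cases "M \<gamma> y" rule: ennreal_cases) (auto simp: top_unique less_top[symmetric])
  finally show ?thesis .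
qed

lemma normY_le:
  assumes "\<And>n. (\<Sum>i=1..n. real i powr \<gamma> * \<bar>y i\<bar>) \<le> C"
  shows "normY \<gamma> y \<le> C"
  unfolding normY_def by (rule infsum_le_if_partial_sums_le) (use assms in auto)

lemma partial_sum_le_normY:
  assumes "y \<in> Y \<gamma>"
  shows "(\<Sum>i=1..n. real i powr \<gamma> * \<bar>y i\<bar>) \<le> normY \<gamma> y"
  unfolding normY_def by (rule finite_sum_le_infsum) (use assms in \<open>auto simp: Y_def\<close>)

lemma M0_le_M1: "(\<And>i. i \<ge> 1 \<Longrightarrow> 0 \<le> y i) \<Longrightarrow> M 0 y \<le> M 1 y"
  unfolding M_def
  by (intro infsum_mono nonneg_summable_on_complete ennreal_leI mult_right_mono) auto

lemma distY_triangle: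
  "x \<in> Y \<gamma> \<Longrightarrow> y \<in> Y \<gamma> \<Longrightarrow> z \<in> Y \<gamma> \<Longrightarrow> distY \<gamma> x z \<le> distY \<gamma> x y + distY \<gamma> y z"
  using Metric_space.triangle[OF Metric_space_Y] .

lemma distY_nonneg: "0 \<le> distY \<gamma> x y"
  using Metric_space.nonneg[OF Metric_space_Y] .

lemma distY_commute: "distY \<gamma> x y = distY \<gamma> y x"
  using Metric_space.commute[OF Metric_space_Y] .

lemma distY1_le:
  "(\<And>n. (\<Sum>i=1..n. real i * \<bar>y i - z i\<bar>) \<le> C) \<Longrightarrow> distY 1 y z \<le> C"
  unfolding distY_def by (rule normY_le) simp

lemma partial_sum_le_distY1:
  assumes "y \<in> Y 1" "z \<in> Y 1"
  shows "(\<Sum>i=1..n. real i * \<bar>y i - z i\<bar>) \<le> distY 1 y z"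
  using partial_sum_le_normY[OF Y_diff[OF assms], of n] by (simp add: distY_def)

lemma moment_mono:
  assumes "\<And>i. i \<ge> 1 \<Longrightarrow> 0 \<le> y i" and "\<gamma> \<le> \<delta>"
  shows "M \<gamma> y \<le> M \<delta> y"
  unfolding M_def using assms
  by (intro infsum_mono nonneg_summable_on_complete ennreal_leI mult_right_mono powr_mono) auto

section \<open>Truncation of the reaction rates to bounded collision mass\<close>

definition net_rate ::
    "(nat \<Rightarrow> nat \<Rightarrow> real) \<Rightarrow> (nat \<Rightarrow> nat \<Rightarrow> nat \<Rightarrow> real) \<Rightarrow> nat \<Rightarrow> (nat \<Rightarrow> real) \<Rightarrow> real" where
  "net_rate a B i y = 1/2 * enn2real (gain a B i y) - enn2real (loss a i y)"

text \<open>The ordered collision pairs of total mass at most \<open>n\<close>. Truncating by total mass keeps the sum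
symmetric in the two colliding particles, and no fragment of such a collision is larger than \<open>n\<close>.\<close>

definition triangle :: "nat \<Rightarrow> (nat \<times> nat) set" where
  "triangle n = {(p, k). 1 \<le> p \<and> 1 \<le> k \<and> p + k \<le> n}"

lemma finite_triangle [simp]: "finite (triangle n)"
  by (rule finite_subset[of _ "{..n} \<times> {..n}"]) (auto simp: triangle_def)

lemma triangle_mono: "m \<le> n \<Longrightarrow> triangle m \<subseteq> triangle n"
  by (auto simp: triangle_def)

text \<open>The gain series is summed along the diagonals \<open>p + k = j\<close>, the loss series along the rows of
constant \<open>p\<close>; on a triangle both become the same finite double sum.\<close>

lemma sum_triangle_diagonals:
  "(\<Sum>(p, k)\<in>triangle n. g p k) = (\<Sum>j=1..n. \<Sum>k=1..j-1. g (j - k) k)"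
proof -
  have "(\<Sum>(p, k)\<in>triangle n. g p k) = (\<Sum>(j, k)\<in>(SIGMA j:{1..n}. {1..j-1}). g (j - k) k)"
    by (rule sum.reindex_bij_witness[of _ "\<lambda>(j, k). (j - k, k)" "\<lambda>(p, k). (p + k, k)"])
      (auto simp: triangle_def)
  then show ?thesis by (simp add: sum.Sigma)
qed

lemma sum_triangle_rows:
  "(\<Sum>(p, k)\<in>triangle n. g p k) = (\<Sum>p=1..n. \<Sum>k=1..n-p. g p k)"
proof -
  have "triangle n = (SIGMA p:{1..n}. {1..n-p})" by (auto simp: triangle_def)
  then show ?thesis by (simp add: sum.Sigma)
qed

lemma sum_triangle_swap:
  "(\<Sum>(p, k)\<in>triangle n. g p k) = (\<Sum>(p, k)\<in>triangle n. g k p)"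
  by (rule sum.reindex_bij_witness[of _ "\<lambda>(p, k). (k, p)" "\<lambda>(p, k). (k, p)"])
    (auto simp: triangle_def)

lemma sum_triangle_product_le:
  fixes u v :: "nat \<Rightarrow> real"
  assumes "\<And>i. i \<ge> 1 \<Longrightarrow> 0 \<le> u i" and "\<And>i. i \<ge> 1 \<Longrightarrow> 0 \<le> v i"
  shows "(\<Sum>(p, k)\<in>triangle n. u p * v k) \<le> (\<Sum>p=1..n. u p) * (\<Sum>k=1..n. v k)"
proof -
  have "(\<Sum>(p, k)\<in>triangle n. u p * v k) \<le> (\<Sum>(p, k)\<in>{1..n} \<times> {1..n}. u p * v k)"
    using assms by (intro sum_mono2) (auto simp: triangle_def)
  then show ?thesis by (simp add: sum_product sum.cartesian_product)
qed

definition gain_trunc ::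
    "(nat \<Rightarrow> nat \<Rightarrow> real) \<Rightarrow> (nat \<Rightarrow> nat \<Rightarrow> nat \<Rightarrow> real) \<Rightarrow> nat \<Rightarrow> nat \<Rightarrow> (nat \<Rightarrow> real) \<Rightarrow> real" where
  "gain_trunc a B n i y = (\<Sum>(p, k)\<in>triangle n. B p k i * a p k * y p * y k)"

text \<open>The bound \<open>n - i\<close> on the collision partner makes the pairs \<open>(i, k)\<close> of the loss run through
the same triangle as those of the gain.\<close>

definition loss_trunc ::
    "(nat \<Rightarrow> nat \<Rightarrow> real) \<Rightarrow> nat \<Rightarrow> nat \<Rightarrow> (nat \<Rightarrow> real) \<Rightarrow> real" where
  "loss_trunc a n i y = (\<Sum>k=1..n-i. a i k * y i * y k)"

definition rate_trunc ::
    "(nat \<Rightarrow> nat \<Rightarrow> real) \<Rightarrow> (nat \<Rightarrow> nat \<Rightarrow> nat \<Rightarrow> real) \<Rightarrow> nat \<Rightarrow> nat \<Rightarrow> (nat \<Rightarrow> real) \<Rightarrow> real" where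
  "rate_trunc a B n i y = 1/2 * gain_trunc a B n i y - loss_trunc a n i y"

lemma tendsto_enn2real_of_bounded:
  fixes f :: "nat \<Rightarrow> real"
  assumes lim: "(\<lambda>n. ennreal (f n)) \<longlonglongrightarrow> L" and nonneg: "\<And>n. 0 \<le> f n" and le: "\<And>n. f n \<le> C"
  shows "f \<longlonglongrightarrow> enn2real L"
proof -
  have "L \<le> ennreal C"
    using le by (intro LIMSEQ_le_const2[OF lim]) (auto intro: ennreal_leI)
  then obtain l where l: "0 \<le> l" "L = ennreal l" by (cases L) (auto simp: top_unique)
  have "f \<longlonglongrightarrow> l"
  proof (rule tendsto_ennrealD)
    show "(\<lambda>n. ennreal (f n)) \<longlonglongrightarrow> ennreal l" using lim unfolding l(2) .
    show "\<forall>\<^sub>F n in sequentially. 0 \<le> f n" using nonneg by (intro always_eventually allI)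
  qed (rule l(1))
  then show ?thesis unfolding l(2) enn2real_ennreal[OF l(1)] .
qed

locale collision_breakage =
  fixes A \<alpha> \<beta> :: real and B :: "nat \<Rightarrow> nat \<Rightarrow> nat \<Rightarrow> real"
  assumes A_pos: "A > 0" and \<alpha>_le_\<beta>: "\<alpha> \<le> \<beta>" and \<beta>_le_1: "\<beta> \<le> 1" and \<beta>_pos: "\<beta> > 0"
    and B1: "cond_B1 B"
begin

abbreviation a :: "nat \<Rightarrow> nat \<Rightarrow> real" where "a \<equiv> coll_kernel A \<alpha> \<beta>"

lemma a_nonneg: "0 \<le> a i j"
  using A_pos by (simp add: coll_kernel_def)

lemma a_sym: "a i j = a j i"
  by (simp add: coll_kernel_def algebra_simps)

lemma a_le:
  assumes "p \<ge> 1" "k \<ge> 1"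
  shows "a p k \<le> 2 * A * (real p powr \<beta> * real k powr \<beta>)"
proof -
  have "real p powr \<alpha> * real k powr \<beta> \<le> real p powr \<beta> * real k powr \<beta>"
    "real p powr \<beta> * real k powr \<alpha> \<le> real p powr \<beta> * real k powr \<beta>"
    using assms \<alpha>_le_\<beta> by (auto intro!: mult_right_mono mult_left_mono powr_mono)
  then have "A * (real p powr \<alpha> * real k powr \<beta> + real p powr \<beta> * real k powr \<alpha>)
      \<le> A * (2 * (real p powr \<beta> * real k powr \<beta>))"
    using A_pos by (intro mult_left_mono) auto
  then show ?thesis by (simp add: coll_kernel_def)
qed

text \<open>Here \<open>\<beta> \<le> 1\<close> enters: the variable
\<open>p\<close>, which will carry the difference of the two solutions, appears with the power one of the norm
of \<open>Y\<^sub>1\<close>, and the other variable is left to a moment of order \<open>1 + \<beta>\<close>.\<close>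

lemma weighted_a_le:
  assumes "p \<ge> 1" "k \<ge> 1"
  shows "real k * a p k \<le> 2 * A * (real p * real k powr (1 + \<beta>))"
proof -
  have "real p powr \<beta> \<le> real p powr 1" using assms \<beta>_le_1 by (intro powr_mono) auto
  then have "real p powr \<beta> * real k powr (1 + \<beta>) \<le> real p * real k powr (1 + \<beta>)"
    by (intro mult_right_mono) auto
  moreover have "real k * (real p powr \<beta> * real k powr \<beta>) = real p powr \<beta> * real k powr (1 + \<beta>)"
    using assms by (simp add: powr_add mult.left_commute)
  ultimately have "real k * (2 * A * (real p powr \<beta> * real k powr \<beta>)) \<le> 2 * A * (real p * real k powr (1 + \<beta>))"
    using A_pos by (metis mult.left_commute mult_left_mono zero_le_mult_iff less_imp_le zero_le_numeral)
  moreover have "real k * a p k \<le> real k * (2 * A * (real p powr \<beta> * real k powr \<beta>))"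
    using a_le[OF assms] by (intro mult_left_mono) auto
  ultimately show ?thesis by linarith
qed

text \<open>The square of the total mass is one factor for the mass carried by a collision and one factor to
gain \<open>1/N\<close> on collisions of total mass above \<open>N\<close>. The bound rests on \<open>p + k \<le> 2 p k\<close>.\<close>

lemma square_weighted_a_le:
  assumes "p \<ge> 1" "k \<ge> 1"
  shows "(real p + real k)\<^sup>2 * a p k \<le> 8 * A * (real p powr (2 + \<beta>) * real k powr (2 + \<beta>))"
proof -
  have "real p * 1 \<le> real p * real k" "1 * real k \<le> real p * real k"
    using assms by (intro mult_left_mono mult_right_mono; simp)+
  then have "(real p + real k)\<^sup>2 \<le> (2 * (real p * real k))\<^sup>2"
    by (intro power_mono) auto
  then have "(real p + real k)\<^sup>2 * a p k \<le> (2 * (real p * real k))\<^sup>2 * (2 * A * (real p powr \<beta> * real k powr \<beta>))"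
    using a_nonneg by (intro mult_mono a_le assms) auto
  also have "\<dots> = 8 * A * (real p powr (2 + \<beta>) * real k powr (2 + \<beta>))"
    using assms by (simp add: powr_add power2_eq_square)
  finally show ?thesis .
qed

lemma B_nonneg: "p \<ge> 1 \<Longrightarrow> k \<ge> 1 \<Longrightarrow> i \<ge> 1 \<Longrightarrow> 0 \<le> B p k i"
  using B1 unfolding cond_B1_def
  by (cases "i \<ge> p + k") (auto simp: Ball_def)

lemma B_eq_0: "p \<ge> 1 \<Longrightarrow> k \<ge> 1 \<Longrightarrow> i \<ge> p + k \<Longrightarrow> B p k i = 0"
  using B1 unfolding cond_B1_def by auto

text \<open>Fragments up to size \<open>n\<close> carry part of the mass \<open>p + k\<close> of the collision, all of it for
\<open>n \<ge> p + k - 1\<close>.\<close>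

lemma B_mass_le:
  assumes "p \<ge> 1" "k \<ge> 1"
  shows "(\<Sum>i=1..n. real i * B p k i) \<le> real p + real k"
proof -
  have "(\<Sum>i=1..n. real i * B p k i) \<le> (\<Sum>i\<in>{1..n} \<union> {1..p+k-1}. real i * B p k i)"
    using B_nonneg assms by (intro sum_mono2) auto
  also have "\<dots> = (\<Sum>i=1..p+k-1. real i * B p k i)"
    using B_eq_0 assms by (intro sum.mono_neutral_right) auto
  also have "\<dots> = real p + real k"
    using B1 assms unfolding cond_B1_def by (metis of_nat_add)
  finally show ?thesis .
qed

text \<open>The partial sums of the gain series over \<open>i < j \<le> n\<close> are sums over the triangle, since a
collision of total mass at most \<open>i\<close> produces no fragment of size \<open>i\<close>.\<close>

lemma gain_trunc_tendsto_gain: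
  assumes y: "\<And>i. i \<ge> 1 \<Longrightarrow> 0 \<le> y i" and "i \<ge> 1"
  shows "(\<lambda>n. ennreal (gain_trunc a B n i y)) \<longlonglongrightarrow> gain a B i y"
proof -
  let ?g = "\<lambda>p k. B p k i * a p k * y p * y k"
  have "(\<Sum>j\<in>{i+1..} \<inter> {..n}. \<Sum>k=1..j-1. ennreal (?g (j - k) k)) = ennreal (gain_trunc a B n i y)" for n
  proof -
    have nn: "0 \<le> ?g (j - k) k" if "k \<in> {1..j-1}" for j k
      using that B_nonneg[of "j - k" k i] a_nonneg y \<open>i \<ge> 1\<close> by (intro mult_nonneg_nonneg) auto
    have "gain_trunc a B n i y = (\<Sum>j=1..n. \<Sum>k=1..j-1. ?g (j - k) k)"
      unfolding gain_trunc_def by (rule sum_triangle_diagonals)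
    also have "\<dots> = (\<Sum>j\<in>{i+1..} \<inter> {..n}. \<Sum>k=1..j-1. ?g (j - k) k)"
    proof (intro sum.mono_neutral_right)
      show "\<forall>j\<in>{1..n} - {i+1..} \<inter> {..n}. (\<Sum>k=1..j-1. ?g (j - k) k) = 0"
      proof (intro ballI sum.neutral)
        fix j k assume "j \<in> {1..n} - {i+1..} \<inter> {..n}" "k \<in> {1..j-1}"
        then have "B (j - k) k i = 0" by (intro B_eq_0) auto
        then show "?g (j - k) k = 0" by simp
      qed
    qed auto
    finally have "ennreal (gain_trunc a B n i y)
        = ennreal (\<Sum>j\<in>{i+1..} \<inter> {..n}. \<Sum>k=1..j-1. ?g (j - k) k)" by simp
    also have "\<dots> = (\<Sum>j\<in>{i+1..} \<inter> {..n}. ennreal (\<Sum>k=1..j-1. ?g (j - k) k))"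
      by (intro sum_ennreal[symmetric] sum_nonneg nn)
    also have "\<dots> = (\<Sum>j\<in>{i+1..} \<inter> {..n}. \<Sum>k=1..j-1. ennreal (?g (j - k) k))"
      by (intro sum.cong refl sum_ennreal[symmetric] nn)
    finally show ?thesis by simp
  qed
  then show ?thesis
    using ennreal_partial_sums_tendsto[where I = "{i+1..}" and f = "\<lambda>j. \<Sum>k=1..j-1. ennreal (?g (j - k) k)"]
    unfolding gain_def by simp
qed

lemma loss_trunc_tendsto_loss:
  assumes y: "\<And>i. i \<ge> 1 \<Longrightarrow> 0 \<le> y i" and "i \<ge> 1"
  shows "(\<lambda>n. ennreal (loss_trunc a n i y)) \<longlonglongrightarrow> loss a i y"
proof -
  let ?l = "\<lambda>k. a i k * y i * y k"
  have eq: "(\<Sum>j\<in>{1..} \<inter> {..n}. ennreal (?l j)) = ennreal (\<Sum>k=1..n. ?l k)" for n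
  proof -
    have "{1..} \<inter> {..n} = {1..n}" by auto
    then show ?thesis using y a_nonneg \<open>i \<ge> 1\<close> by (subst sum_ennreal) auto
  qed
  have "(\<lambda>n. ennreal (\<Sum>k=1..n. ?l k)) \<longlonglongrightarrow> loss a i y"
    using ennreal_partial_sums_tendsto[where I = "{1..}" and f = "\<lambda>j. ennreal (?l j)"]
    unfolding loss_def eq .
  then have "(\<lambda>n. ennreal (\<Sum>k=1..n-i. ?l k)) \<longlonglongrightarrow> loss a i y"
    by (rule filterlim_compose[where f = "\<lambda>n. n - i"]) (rule filterlim_minus_const_nat_at_top)
  then show ?thesis by (simp add: loss_trunc_def)
qed

lemma second_moment_triangle_le:
  assumes y: "\<And>i. i \<ge> 1 \<Longrightarrow> 0 \<le> y i" and Q: "(\<Sum>i=1..n. real i powr (2 + \<beta>) * y i) \<le> Q"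
  shows "(\<Sum>(p, k)\<in>triangle n. (real p + real k)\<^sup>2 * a p k * y p * y k) \<le> 8 * A * Q\<^sup>2"
proof -
  let ?u = "\<lambda>i. real i powr (2 + \<beta>) * y i"
  have u: "0 \<le> ?u i" if "i \<ge> 1" for i using y that by auto
  have "(\<Sum>(p, k)\<in>triangle n. (real p + real k)\<^sup>2 * a p k * y p * y k)
      \<le> (\<Sum>(p, k)\<in>triangle n. 8 * A * (?u p * ?u k))"
  proof (intro sum_mono, clarify)
    fix p k assume "(p, k) \<in> triangle n"
    then have pk: "p \<ge> 1" "k \<ge> 1" by (auto simp: triangle_def)
    have "(real p + real k)\<^sup>2 * a p k * (y p * y k)
        \<le> 8 * A * (real p powr (2 + \<beta>) * real k powr (2 + \<beta>)) * (y p * y k)"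
      using pk y by (intro mult_right_mono square_weighted_a_le) auto
    then show "(real p + real k)\<^sup>2 * a p k * y p * y k \<le> 8 * A * (?u p * ?u k)"
      by (simp add: mult_ac)
  qed
  also have "\<dots> = 8 * A * (\<Sum>(p, k)\<in>triangle n. ?u p * ?u k)"
    by (simp add: sum_distrib_left case_prod_unfold)
  also have "\<dots> \<le> 8 * A * ((\<Sum>p=1..n. ?u p) * (\<Sum>k=1..n. ?u k))"
    using A_pos u by (intro mult_left_mono sum_triangle_product_le) auto
  also have "\<dots> \<le> 8 * A * (Q * Q)"
    using A_pos u Q by (intro mult_left_mono mult_mono sum_nonneg order_trans[OF sum_nonneg Q]) auto
  finally show ?thesis by (simp add: power2_eq_square)
qed

text \<open>Chebyshev's trick: on the collisions left out, the factor \<open>N\<close> is at most the total mass.\<close>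

lemma mass_rate_tail_le:
  assumes y: "\<And>i. i \<ge> 1 \<Longrightarrow> 0 \<le> y i" and Q: "(\<Sum>i=1..n. real i powr (2 + \<beta>) * y i) \<le> Q"
    and "N \<ge> 1"
  shows "(\<Sum>(p, k)\<in>triangle n - triangle N. (real p + real k) * a p k * y p * y k) \<le> 8 * A * Q\<^sup>2 / N"
proof -
  have "(\<Sum>(p, k)\<in>triangle n - triangle N. (real p + real k) * a p k * y p * y k) * N
      = (\<Sum>(p, k)\<in>triangle n - triangle N. (real p + real k) * N * a p k * y p * y k)"
    by (simp add: sum_distrib_left sum_distrib_right case_prod_unfold mult_ac)
  also have "\<dots> \<le> (\<Sum>(p, k)\<in>triangle n - triangle N. (real p + real k)\<^sup>2 * a p k * y p * y k)"
    using y a_nonneg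
    by (intro sum_mono) (auto simp: triangle_def power2_eq_square intro!: mult_right_mono mult_left_mono)
  also have "\<dots> \<le> (\<Sum>(p, k)\<in>triangle n. (real p + real k)\<^sup>2 * a p k * y p * y k)"
    using y a_nonneg by (intro sum_mono2 finite_triangle) (auto simp: triangle_def)
  also have "\<dots> \<le> 8 * A * Q\<^sup>2" by (rule second_moment_triangle_le[OF y Q])
  finally show ?thesis using \<open>N \<ge> 1\<close> by (simp add: pos_le_divide_eq)
qed

lemma gain_trunc_diff:
  "N \<le> n \<Longrightarrow> gain_trunc a B n i y - gain_trunc a B N i y
    = (\<Sum>(p, k)\<in>triangle n - triangle N. B p k i * a p k * y p * y k)"
  unfolding gain_trunc_def by (subst sum_diff) (auto simp: triangle_mono)

text \<open>Interchanging the sums bounds the mass flux into sizes up to \<open>m\<close> by the total mass of the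
collisions concerned.\<close>

lemma gain_trunc_tail_le:
  assumes y: "\<And>i. i \<ge> 1 \<Longrightarrow> 0 \<le> y i" and Q: "(\<Sum>i=1..n. real i powr (2 + \<beta>) * y i) \<le> Q"
    and "N \<ge> 1" "N \<le> n"
  shows "(\<Sum>i=1..m. real i * (gain_trunc a B n i y - gain_trunc a B N i y)) \<le> 8 * A * Q\<^sup>2 / N"
proof -
  let ?D = "triangle n - triangle N"
  have "(\<Sum>i=1..m. real i * (gain_trunc a B n i y - gain_trunc a B N i y))
      = (\<Sum>i=1..m. \<Sum>(p, k)\<in>?D. (real i * B p k i) * (a p k * y p * y k))"
    using \<open>N \<le> n\<close> by (simp add: gain_trunc_diff sum_distrib_left case_prod_unfold mult_ac)
  also have "\<dots> = (\<Sum>(p, k)\<in>?D. (\<Sum>i=1..m. real i * B p k i) * (a p k * y p * y k))"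
    by (subst sum.swap) (simp add: sum_distrib_right case_prod_unfold)
  also have "\<dots> \<le> (\<Sum>(p, k)\<in>?D. (real p + real k) * (a p k * y p * y k))"
  proof (intro sum_mono, clarify)
    fix p k assume "(p, k) \<in> triangle n"
    then have pk: "p \<ge> 1" "k \<ge> 1" by (auto simp: triangle_def)
    then show "(\<Sum>i=1..m. real i * B p k i) * (a p k * y p * y k) \<le> (real p + real k) * (a p k * y p * y k)"
      using y a_nonneg by (intro mult_right_mono B_mass_le) auto
  qed
  also have "\<dots> \<le> 8 * A * Q\<^sup>2 / N"
    using mass_rate_tail_le[OF y Q \<open>N \<ge> 1\<close>] by (simp add: mult_ac)
  finally show ?thesis .
qed

lemma gain_trunc_mono:
  assumes y: "\<And>i. i \<ge> 1 \<Longrightarrow> 0 \<le> y i" and "i \<ge> 1" and "N \<le> n"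
  shows "gain_trunc a B N i y \<le> gain_trunc a B n i y"
  unfolding gain_trunc_def using assms B_nonneg a_nonneg
  by (intro sum_mono2 triangle_mono finite_triangle) (auto simp: triangle_def)

lemma gain_trunc_nonneg:
  "(\<And>i. i \<ge> 1 \<Longrightarrow> 0 \<le> y i) \<Longrightarrow> i \<ge> 1 \<Longrightarrow> 0 \<le> gain_trunc a B n i y"
  unfolding gain_trunc_def using B_nonneg a_nonneg by (intro sum_nonneg) (auto simp: triangle_def)

text \<open>A bound uniform in \<open>n\<close> makes the sum of the gain series finite.\<close>

lemma gain_trunc_le:
  assumes y: "\<And>i. i \<ge> 1 \<Longrightarrow> 0 \<le> y i" and Q: "\<And>n. (\<Sum>i=1..n. real i powr (2 + \<beta>) * y i) \<le> Q"
    and "i \<ge> 1"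
  shows "gain_trunc a B n i y \<le> 8 * A * Q\<^sup>2"
proof (cases "n \<ge> 1")
  case True
  \<comment> \<open>Since two particles have total mass at least two, the tail estimate at \<open>N = 1\<close> bounds the whole sum.\<close>
  have e: "triangle (Suc 0) = {}" by (auto simp: triangle_def)
  have "real i * gain_trunc a B n i y \<le> (\<Sum>j=1..i. real j * (gain_trunc a B n j y - gain_trunc a B 1 j y))"
    using \<open>i \<ge> 1\<close> y True gain_trunc_mono[of y _ 1 n]
    by (intro order_trans[OF _ member_le_sum[of i]]) (auto simp: gain_trunc_def e)
  also have "\<dots> \<le> 8 * A * Q\<^sup>2" using gain_trunc_tail_le[OF y Q, of 1 n i] True by simp
  finally have "real i * gain_trunc a B n i y \<le> 8 * A * Q\<^sup>2" .
  moreover have "1 * gain_trunc a B n i y \<le> real i * gain_trunc a B n i y"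
    using \<open>i \<ge> 1\<close> y by (intro mult_right_mono gain_trunc_nonneg) auto
  ultimately show ?thesis by simp
next
  case False
  then have "triangle n = {}" by (auto simp: triangle_def)
  then show ?thesis using A_pos by (simp add: gain_trunc_def)
qed

lemma loss_trunc_tail_le:
  assumes y: "\<And>i. i \<ge> 1 \<Longrightarrow> 0 \<le> y i" and Q: "(\<Sum>i=1..n. real i powr (2 + \<beta>) * y i) \<le> Q"
    and "N \<ge> 1" "N \<le> n"
  shows "(\<Sum>i=1..N. real i * (loss_trunc a n i y - loss_trunc a N i y)) \<le> 8 * A * Q\<^sup>2 / N"
proof -
  have eq: "(\<Sum>i=1..m. real i * loss_trunc a m i y) = (\<Sum>(p, k)\<in>triangle m. real p * a p k * y p * y k)" for m
    by (simp add: sum_triangle_rows loss_trunc_def sum_distrib_left mult_ac)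
  have mono: "loss_trunc a n i y \<ge> 0" if "i \<ge> 1" for i
    unfolding loss_trunc_def using y a_nonneg that by (intro sum_nonneg) auto
  have "(\<Sum>i=1..N. real i * (loss_trunc a n i y - loss_trunc a N i y))
      = (\<Sum>i=1..N. real i * loss_trunc a n i y) - (\<Sum>i=1..N. real i * loss_trunc a N i y)"
    by (simp add: right_diff_distrib sum_subtractf)
  also have "(\<Sum>i=1..N. real i * loss_trunc a n i y) \<le> (\<Sum>i=1..n. real i * loss_trunc a n i y)"
    using \<open>N \<le> n\<close> mono by (intro sum_mono2) auto
  also have "(\<Sum>i=1..n. real i * loss_trunc a n i y) - (\<Sum>i=1..N. real i * loss_trunc a N i y)
      = (\<Sum>(p, k)\<in>triangle n - triangle N. real p * a p k * y p * y k)"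
    unfolding eq using \<open>N \<le> n\<close> by (subst sum_diff) (auto simp: triangle_mono)
  also have "\<dots> \<le> (\<Sum>(p, k)\<in>triangle n - triangle N. (real p + real k) * a p k * y p * y k)"
    using y a_nonneg by (intro sum_mono) (auto simp: triangle_def intro!: mult_right_mono)
  also have "\<dots> \<le> 8 * A * Q\<^sup>2 / N" by (rule mass_rate_tail_le[OF y Q \<open>N \<ge> 1\<close>])
  finally show ?thesis by simp
qed

lemma loss_trunc_le:
  assumes y: "\<And>i. i \<ge> 1 \<Longrightarrow> 0 \<le> y i" and Q: "\<And>n. (\<Sum>i=1..n. real i powr (2 + \<beta>) * y i) \<le> Q"
    and "i \<ge> 1"
  shows "loss_trunc a n i y \<le> 8 * A * Q\<^sup>2"
proof -
  let ?t = "\<lambda>(p, k). (real p + real k)\<^sup>2 * a p k * y p * y k"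
  have "loss_trunc a n i y = (\<Sum>x\<in>Pair i ` {1..n-i}. case x of (p, k) \<Rightarrow> a p k * y p * y k)"
    unfolding loss_trunc_def by (subst sum.reindex) (auto simp: inj_on_def)
  also have "\<dots> \<le> (\<Sum>x\<in>Pair i ` {1..n-i}. ?t x)"
  proof (rule sum_mono, clarsimp)
    fix k assume "Suc 0 \<le> k" "k \<le> n - i"
    have "1\<^sup>2 \<le> (real i + real k)\<^sup>2" using \<open>i \<ge> 1\<close> by (intro power_mono) auto
    then have "1 * (a i k * y i * y k) \<le> (real i + real k)\<^sup>2 * (a i k * y i * y k)"
      using \<open>i \<ge> 1\<close> \<open>Suc 0 \<le> k\<close> y a_nonneg by (intro mult_right_mono) auto
    then show "a i k * y i * y k \<le> (real i + real k)\<^sup>2 * a i k * y i * y k" by (simp add: mult_ac)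
  qed
  also have "\<dots> \<le> (\<Sum>x\<in>triangle n. ?t x)"
    using y a_nonneg \<open>i \<ge> 1\<close> by (intro sum_mono2 finite_triangle) (auto simp: triangle_def)
  also have "\<dots> \<le> 8 * A * Q\<^sup>2" by (rule second_moment_triangle_le[OF y Q])
  finally show ?thesis .
qed

text \<open>The truncated sums at level \<open>n \<ge> N\<close> differ from those at level \<open>N\<close> by a tail that does not
depend on \<open>n\<close>; letting \<open>n\<close> tend to infinity gives the error of the full rate. The constant is
\<open>8/2\<close> from the gain and \<open>8\<close> from the loss.\<close>

lemma net_rate_trunc_error:
  assumes y: "\<And>i. i \<ge> 1 \<Longrightarrow> 0 \<le> y i" and Q: "\<And>n. (\<Sum>i=1..n. real i powr (2 + \<beta>) * y i) \<le> Q"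
    and "N \<ge> 1"
  shows "(\<Sum>i=1..N. real i * \<bar>net_rate a B i y - rate_trunc a B N i y\<bar>) \<le> 12 * A * Q\<^sup>2 / N"
proof -
  let ?dg = "\<lambda>n i. gain_trunc a B n i y - gain_trunc a B N i y"
  let ?dl = "\<lambda>n i. loss_trunc a n i y - loss_trunc a N i y"
  have g: "(\<lambda>n. gain_trunc a B n i y) \<longlonglongrightarrow> enn2real (gain a B i y)"
    and l: "(\<lambda>n. loss_trunc a n i y) \<longlonglongrightarrow> enn2real (loss a i y)" if "i \<in> {1..N}" for i
  proof -
    have "0 \<le> gain_trunc a B n i y" "0 \<le> loss_trunc a n i y" for n
      using that y B_nonneg a_nonneg unfolding gain_trunc_def loss_trunc_def
      by (auto intro!: sum_nonneg simp: triangle_def)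
    then show "(\<lambda>n. gain_trunc a B n i y) \<longlonglongrightarrow> enn2real (gain a B i y)"
      "(\<lambda>n. loss_trunc a n i y) \<longlonglongrightarrow> enn2real (loss a i y)"
      using that gain_trunc_tendsto_gain[of y i] loss_trunc_tendsto_loss[of y i]
        gain_trunc_le[of y Q i] loss_trunc_le[of y Q i] y Q
      by (auto intro!: tendsto_enn2real_of_bounded[where C = "8 * A * Q\<^sup>2"])
  qed
  have bd: "(\<Sum>i=1..N. real i * \<bar>(1/2 * gain_trunc a B n i y - loss_trunc a n i y) - rate_trunc a B N i y\<bar>)
      \<le> 12 * A * Q\<^sup>2 / N" if "n \<ge> N" for n
  proof -
    have dg: "?dg n i \<ge> 0" and dl: "?dl n i \<ge> 0" if "i \<in> {1..N}" for i
      using gain_trunc_mono[of y i N n] y that \<open>n \<ge> N\<close> a_nonneg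
      by (auto simp: loss_trunc_def intro!: sum_mono2)
    have "(\<Sum>i=1..N. real i * \<bar>(1/2 * gain_trunc a B n i y - loss_trunc a n i y) - rate_trunc a B N i y\<bar>)
        \<le> (\<Sum>i=1..N. real i * (1/2 * ?dg n i + ?dl n i))"
    proof (intro sum_mono mult_left_mono)
      fix i assume "i \<in> {1..N}"
      with dg[OF this] dl[OF this]
      show "\<bar>(1/2 * gain_trunc a B n i y - loss_trunc a n i y) - rate_trunc a B N i y\<bar> \<le> 1/2 * ?dg n i + ?dl n i"
        unfolding rate_trunc_def by (simp add: abs_le_iff field_simps)
    qed auto
    also have "\<dots> = 1/2 * (\<Sum>i=1..N. real i * ?dg n i) + (\<Sum>i=1..N. real i * ?dl n i)"
      by (simp add: sum_distrib_left sum.distrib[symmetric] algebra_simps)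
    also have "\<dots> \<le> 1/2 * (8 * A * Q\<^sup>2 / N) + 8 * A * Q\<^sup>2 / N"
      using gain_trunc_tail_le[OF y Q \<open>N \<ge> 1\<close> that, of N] loss_trunc_tail_le[OF y Q \<open>N \<ge> 1\<close> that] by linarith
    finally show ?thesis by simp
  qed
  have "(\<lambda>n. \<Sum>i=1..N. real i * \<bar>(1/2 * gain_trunc a B n i y - loss_trunc a n i y) - rate_trunc a B N i y\<bar>)
      \<longlonglongrightarrow> (\<Sum>i=1..N. real i * \<bar>net_rate a B i y - rate_trunc a B N i y\<bar>)"
    unfolding net_rate_def by (intro tendsto_intros g l)
  then show ?thesis by (rule LIMSEQ_le_const2) (use bd in blast)
qed

section \<open>The dissipation estimate in \<open>Y\<^sub>1\<close>\<close>

text \<open>The core of the proof. After symmetrisation every pair is weighted with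
\<open>D p k = \<Sum>\<^sub>i i \<sigma>\<^sub>i B\<^sub>p\<^sub>k\<^sup>i - p \<sigma>\<^sub>p - k \<sigma>\<^sub>k\<close>. When it multiplies \<open>x\<^sub>p\<close>, the choice of \<open>\<sigma>\<close> turns
\<open>- p \<sigma>\<^sub>p x\<^sub>p\<close> into \<open>- p |x\<^sub>p|\<close>, which absorbs the part \<open>p |x\<^sub>p|\<close> of the fragment term and leaves
\<open>2 k |x\<^sub>p|\<close>, so that only the first moment of \<open>x\<close> remains.\<close>

lemma truncated_rate_difference_le:
  assumes w: "\<And>i. i \<ge> 1 \<Longrightarrow> 0 \<le> w i" and z: "\<And>i. i \<ge> 1 \<Longrightarrow> 0 \<le> z i"
    and Cw: "(\<Sum>i=1..N. real i powr (1 + \<beta>) * w i) \<le> C" and Cz: "(\<Sum>i=1..N. real i powr (1 + \<beta>) * z i) \<le> C"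
    and \<sigma>: "\<And>i. \<bar>\<sigma> i\<bar> \<le> 1" "\<And>i. i \<ge> 1 \<Longrightarrow> \<sigma> i * (w i - z i) = \<bar>w i - z i\<bar>"
  shows "(\<Sum>i=1..N. real i * \<sigma> i * (rate_trunc a B N i w - rate_trunc a B N i z))
    \<le> 4 * A * C * (\<Sum>i=1..N. real i * \<bar>w i - z i\<bar>)"
proof -
  define x where "x i = w i - z i" for i
  define s where "s i = (w i + z i) / 2" for i
  define D where "D p k = (\<Sum>i=1..N. real i * \<sigma> i * B p k i) - real p * \<sigma> p - real k * \<sigma> k" for p k
  let ?T = "triangle N"
  let ?L = "\<Sum>i=1..N. real i * \<bar>x i\<bar>"
  let ?u = "\<lambda>p k. w p * w k - z p * z k"
  have u: "?u p k = x p * s k + s p * x k" for p k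
    by (simp add: x_def s_def field_simps)
  have s0: "0 \<le> s i" if "i \<ge> 1" for i using w z that by (simp add: s_def)
  have gain_part: "(\<Sum>i=1..N. real i * \<sigma> i * (gain_trunc a B N i w - gain_trunc a B N i z))
      = (\<Sum>(p, k)\<in>?T. a p k * ?u p k * (\<Sum>i=1..N. real i * \<sigma> i * B p k i))"
  proof -
    have "(\<Sum>i=1..N. real i * \<sigma> i * (gain_trunc a B N i w - gain_trunc a B N i z))
        = (\<Sum>i=1..N. \<Sum>(p, k)\<in>?T. a p k * ?u p k * (real i * \<sigma> i * B p k i))"
      unfolding gain_trunc_def sum_subtractf[symmetric] sum_distrib_left
      by (intro sum.cong refl) (simp add: case_prod_unfold algebra_simps)
    also have "\<dots> = (\<Sum>(p, k)\<in>?T. a p k * ?u p k * (\<Sum>i=1..N. real i * \<sigma> i * B p k i))"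
      by (subst sum.swap) (simp add: sum_distrib_left case_prod_unfold)
    finally show ?thesis .
  qed
  have loss_rows: "(\<Sum>i=1..N. real i * \<sigma> i * (loss_trunc a N i w - loss_trunc a N i z))
      = (\<Sum>(p, k)\<in>?T. a p k * ?u p k * (real p * \<sigma> p))"
    unfolding sum_triangle_rows loss_trunc_def sum_subtractf[symmetric] sum_distrib_left
    by (intro sum.cong refl) (simp add: algebra_simps)
  \<comment> \<open>The loss is written both by its first and by its second index; half of each restores the symmetry.\<close>
  also have "\<dots> = (\<Sum>(p, k)\<in>?T. a p k * ?u p k * (real k * \<sigma> k))"
    by (subst sum_triangle_swap) (simp add: a_sym mult.commute)
  finally have loss_columns: "(\<Sum>i=1..N. real i * \<sigma> i * (loss_trunc a N i w - loss_trunc a N i z))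
      = (\<Sum>(p, k)\<in>?T. a p k * ?u p k * (real k * \<sigma> k))" .
  have "(\<Sum>i=1..N. real i * \<sigma> i * (rate_trunc a B N i w - rate_trunc a B N i z))
      = 1/2 * (\<Sum>i=1..N. real i * \<sigma> i * (gain_trunc a B N i w - gain_trunc a B N i z))
        - (\<Sum>i=1..N. real i * \<sigma> i * (loss_trunc a N i w - loss_trunc a N i z))"
    by (simp add: rate_trunc_def sum_distrib_left sum_subtractf[symmetric] algebra_simps)
  also have "\<dots> = 1/2 * ((\<Sum>(p, k)\<in>?T. a p k * ?u p k * (\<Sum>i=1..N. real i * \<sigma> i * B p k i))
      - (\<Sum>(p, k)\<in>?T. a p k * ?u p k * (real p * \<sigma> p)) - (\<Sum>(p, k)\<in>?T. a p k * ?u p k * (real k * \<sigma> k)))"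
  proof -
    have "1/2 * g - l = 1/2 * (g' - l1 - l2)" if "g = g'" "l = l1" "l = l2" for g g' l l1 l2 :: real
      using that by (simp add: field_simps)
    then show ?thesis using gain_part loss_rows loss_columns .
  qed
  also have "\<dots> = 1/2 * (\<Sum>(p, k)\<in>?T. a p k * ?u p k * D p k)"
    unfolding D_def sum_subtractf[symmetric] by (simp add: case_prod_unfold right_diff_distrib)
  also have "\<dots> \<le> 1/2 * (\<Sum>(p, k)\<in>?T. 4 * A * ((real p * \<bar>x p\<bar>) * (real k powr (1 + \<beta>) * s k))
      + 4 * A * ((real p powr (1 + \<beta>) * s p) * (real k * \<bar>x k\<bar>)))"
  proof (intro mult_left_mono sum_mono, clarify)
    fix p k assume "(p, k) \<in> ?T"
    then have pk: "p \<ge> 1" "k \<ge> 1" by (auto simp: triangle_def)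
    have fragments: "\<bar>\<Sum>i=1..N. real i * \<sigma> i * B p k i\<bar> \<le> real p + real k"
    proof -
      have "\<bar>\<Sum>i=1..N. real i * \<sigma> i * B p k i\<bar> \<le> (\<Sum>i=1..N. \<bar>real i * \<sigma> i * B p k i\<bar>)" by (rule sum_abs)
      also have "\<dots> \<le> (\<Sum>i=1..N. real i * B p k i)"
      proof (rule sum_mono)
        fix i assume "i \<in> {1..N}"
        then have "0 \<le> B p k i" using B_nonneg pk by auto
        then show "\<bar>real i * \<sigma> i * B p k i\<bar> \<le> real i * B p k i"
          using \<sigma>(1)[of i] mult_right_mono[of "\<bar>\<sigma> i\<bar>" 1 "real i * B p k i"]
          by (simp add: abs_mult mult_ac)
      qed
      also have "\<dots> \<le> real p + real k" using B_mass_le pk by simp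
      finally show ?thesis .
    qed
    have one: "x p * D p k \<le> 2 * real k * \<bar>x p\<bar>" and two: "x k * D p k \<le> 2 * real p * \<bar>x k\<bar>"
    proof -
      let ?S = "\<Sum>i=1..N. real i * \<sigma> i * B p k i"
      have S: "x q * ?S \<le> \<bar>x q\<bar> * (real p + real k)" for q
        using mult_left_mono[OF fragments, of "\<bar>x q\<bar>"] abs_ge_self[of "x q * ?S"] by (simp add: abs_mult)
      have other: "- (x q * (real r * \<sigma> r)) \<le> \<bar>x q\<bar> * real r" for q r
        using mult_left_mono[OF \<sigma>(1)[of r], of "\<bar>x q\<bar> * real r"] abs_ge_minus_self[of "x q * (real r * \<sigma> r)"]
        by (simp add: abs_mult mult_ac)
      have self: "x q * (real q * \<sigma> q) = real q * \<bar>x q\<bar>" if "q \<ge> 1" for q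
        using \<sigma>(2)[OF that] by (simp add: x_def algebra_simps)
      show "x p * D p k \<le> 2 * real k * \<bar>x p\<bar>"
        using S[of p] other[of p k] self[of p] pk by (simp add: D_def algebra_simps)
      show "x k * D p k \<le> 2 * real p * \<bar>x k\<bar>"
        using S[of k] other[of k p] self[of k] pk by (simp add: D_def algebra_simps)
    qed
    have "a p k * ?u p k * D p k = a p k * s k * (x p * D p k) + a p k * s p * (x k * D p k)"
      unfolding u by (simp add: algebra_simps)
    also have "\<dots> \<le> a p k * s k * (2 * real k * \<bar>x p\<bar>) + a p k * s p * (2 * real p * \<bar>x k\<bar>)"
      using one two a_nonneg s0 pk by (intro add_mono mult_left_mono) auto
    also have "\<dots> = (real k * a p k) * (2 * \<bar>x p\<bar> * s k) + (real p * a k p) * (2 * s p * \<bar>x k\<bar>)"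
      by (simp add: a_sym[of k p] algebra_simps)
    also have "\<dots> \<le> (2 * A * (real p * real k powr (1 + \<beta>))) * (2 * \<bar>x p\<bar> * s k)
        + (2 * A * (real k * real p powr (1 + \<beta>))) * (2 * s p * \<bar>x k\<bar>)"
      using pk s0 by (intro add_mono mult_right_mono weighted_a_le) auto
    finally show "a p k * ?u p k * D p k \<le> 4 * A * ((real p * \<bar>x p\<bar>) * (real k powr (1 + \<beta>) * s k))
      + 4 * A * ((real p powr (1 + \<beta>) * s p) * (real k * \<bar>x k\<bar>))"
      by (simp add: mult_ac)
  qed auto
  also have "\<dots> = 2 * A * (\<Sum>(p, k)\<in>?T. (real p * \<bar>x p\<bar>) * (real k powr (1 + \<beta>) * s k))
      + 2 * A * (\<Sum>(p, k)\<in>?T. (real p powr (1 + \<beta>) * s p) * (real k * \<bar>x k\<bar>))"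
    by (simp add: sum.distrib sum_distrib_left case_prod_unfold mult_ac)
  also have "\<dots> \<le> 2 * A * (?L * (\<Sum>k=1..N. real k powr (1 + \<beta>) * s k))
      + 2 * A * ((\<Sum>p=1..N. real p powr (1 + \<beta>) * s p) * ?L)"
    using A_pos s0 by (intro add_mono mult_left_mono sum_triangle_product_le) auto
  also have "\<dots> = 4 * A * ?L * (\<Sum>k=1..N. real k powr (1 + \<beta>) * s k)"
    by (simp add: mult_ac)
  also have "\<dots> \<le> 4 * A * ?L * C"
  proof (rule mult_left_mono)
    have "(\<Sum>k=1..N. real k powr (1 + \<beta>) * s k)
        = ((\<Sum>k=1..N. real k powr (1 + \<beta>) * w k) + (\<Sum>k=1..N. real k powr (1 + \<beta>) * z k)) / 2"
      by (simp add: s_def sum.distrib[symmetric] sum_divide_distrib algebra_simps)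
    then show "(\<Sum>k=1..N. real k powr (1 + \<beta>) * s k) \<le> C" using Cw Cz by simp
    show "0 \<le> 4 * A * ?L" using A_pos by (intro mult_nonneg_nonneg sum_nonneg) auto
  qed
  finally show ?thesis by (simp add: x_def mult_ac)
qed

end

section \<open>From truncated rates to stability\<close>

text \<open>A mean value inequality for functions that are merely continuous: the set of left end points
\<open>t\<close> for which the bound holds on \<open>[t, b]\<close> is closed, and the local hypothesis pushes its infimum
down to \<open>a\<close>.\<close>

lemma left_Dini_bound:
  fixes \<phi> :: "real \<Rightarrow> real"
  assumes "a \<le> b" and cont: "continuous_on {a..b} \<phi>"
    and step: "\<And>t. a < t \<Longrightarrow> t \<le> b \<Longrightarrow>
      \<exists>\<eta>>0. \<forall>s. a \<le> s \<and> t - \<eta> < s \<and> s < t \<longrightarrow> \<phi> t - \<phi> s \<le> e * (t - s)"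
  shows "\<phi> b - \<phi> a \<le> e * (b - a)"
proof -
  define V where "V = {t \<in> {a..b}. \<phi> b - \<phi> t \<le> e * (b - t)}"
  have closed: "closed V"
  proof -
    have "continuous_on {a..b} (\<lambda>t. e * (b - t) - (\<phi> b - \<phi> t))"
      by (intro continuous_intros cont)
    then have "closed ({a..b} \<inter> (\<lambda>t. e * (b - t) - (\<phi> b - \<phi> t)) -` {0..})"
      by (intro continuous_closed_preimage) auto
    also have "{a..b} \<inter> (\<lambda>t. e * (b - t) - (\<phi> b - \<phi> t)) -` {0..} = V"
      by (auto simp: V_def)
    finally show ?thesis .
  qed
  have bV: "b \<in> V" using \<open>a \<le> b\<close> by (auto simp: V_def)
  have bdd: "bdd_below V" by (auto simp: V_def intro!: bdd_belowI[of _ a])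
  define t where "t = Inf V"
  have tV: "t \<in> V" unfolding t_def using closed bV bdd by (intro closed_contains_Inf) auto
  have "t = a"
  proof (rule ccontr)
    assume "t \<noteq> a"
    with tV have t: "a < t" "t \<le> b" by (auto simp: V_def)
    then obtain \<eta> where \<eta>: "\<eta> > 0" "\<And>s. a \<le> s \<Longrightarrow> t - \<eta> < s \<Longrightarrow> s < t \<Longrightarrow> \<phi> t - \<phi> s \<le> e * (t - s)"
      using step by meson
    define s where "s = max a (t - \<eta>/2)"
    have s: "a \<le> s" "t - \<eta> < s" "s < t" using t \<eta>(1) by (auto simp: s_def)
    have "\<phi> b - \<phi> s \<le> e * (b - s)"
      using \<eta>(2)[OF s] tV by (auto simp: V_def algebra_simps)
    then have "s \<in> V" using s t by (auto simp: V_def)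
    then have "t \<le> s" unfolding t_def using bdd by (rule cInf_lower)
    with s show False by simp
  qed
  with tV show ?thesis by (simp add: V_def)
qed

context collision_breakage
begin

text \<open>Solutions as used in the estimates: the integrated equation is required between positive times only,
where higher moments are available, and in terms of increments, so that the notion is visibly
invariant under shifts in time.\<close>

definition evolution :: "(real \<Rightarrow> nat \<Rightarrow> real) \<Rightarrow> bool" where
  "evolution w \<longleftrightarrow> (\<forall>t\<ge>0. w t 0 = 0 \<and> (\<forall>i\<ge>1. 0 \<le> w t i)) \<and>
     (\<forall>i. continuous_on {0..} (\<lambda>t. w t i)) \<and>
     (\<forall>i\<ge>1. \<forall>s t. 0 < s \<and> s \<le> t \<longrightarrow>
        ((\<lambda>\<tau>. net_rate a B i (w \<tau>)) has_integral (w t i - w s i)) {s..t})"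

text \<open>Adds the moment bounds under which the stability estimate holds: uniform in time for the order
\<open>1 + \<beta>\<close>, which fixes the growth rate, and away from \<open>0\<close> for the order \<open>2 + \<beta>\<close>, which
controls the truncation error.\<close>

definition regular_evolution :: "real \<Rightarrow> (real \<Rightarrow> nat \<Rightarrow> real) \<Rightarrow> bool" where
  "regular_evolution C w \<longleftrightarrow> evolution w \<and> (\<forall>t\<ge>0. M (1 + \<beta>) (w t) \<le> ennreal C) \<and>
     (\<forall>\<delta>>0. \<exists>Q\<ge>0. \<forall>t\<ge>\<delta>. M (2 + \<beta>) (w t) \<le> ennreal Q)"

lemma evolution_nonneg: "evolution w \<Longrightarrow> t \<ge> 0 \<Longrightarrow> i \<ge> 1 \<Longrightarrow> 0 \<le> w t i"
  by (simp add: evolution_def)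

lemma evolution_continuous: "evolution w \<Longrightarrow> I \<subseteq> {0..} \<Longrightarrow> continuous_on I (\<lambda>t. w t i)"
  by (auto simp: evolution_def intro: continuous_on_subset)

lemma regular_evolution_in_Y:
  assumes "regular_evolution C w" "t \<ge> 0"
  shows "w t \<in> Y 1"
proof -
  have nn: "w t 0 = 0" "\<And>i. i \<ge> 1 \<Longrightarrow> 0 \<le> w t i"
    using assms by (auto simp: regular_evolution_def evolution_def)
  have "M 1 (w t) \<le> M (1 + \<beta>) (w t)" using nn \<beta>_pos by (intro moment_mono) auto
  also have "\<dots> < \<infinity>"
    using assms by (auto simp: regular_evolution_def intro: le_less_trans)
  finally show ?thesis using in_Y_iff_moment_finite[of "w t" 1] nn by auto
qed

text \<open>For the truncated distance \<open>L\<close>, the left difference quotients are bounded by \<open>K L + E\<close> up to any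
\<open>\<epsilon> > 0\<close>, where \<open>E\<close> is the truncation error of both solutions. Multiplying by the decreasing
exponential removes \<open>K L\<close>.\<close>

lemma distance_growth_truncated:
  assumes w: "evolution w" and z: "evolution z" and "0 < \<delta>" "\<delta> \<le> T" "N \<ge> 1" "C \<ge> 0"
    and Cw: "\<And>t n. t \<in> {\<delta>..T} \<Longrightarrow> (\<Sum>i=1..n. real i powr (1 + \<beta>) * w t i) \<le> C"
    and Cz: "\<And>t n. t \<in> {\<delta>..T} \<Longrightarrow> (\<Sum>i=1..n. real i powr (1 + \<beta>) * z t i) \<le> C"
    and Qw: "\<And>t n. t \<in> {\<delta>..T} \<Longrightarrow> (\<Sum>i=1..n. real i powr (2 + \<beta>) * w t i) \<le> Q"
    and Qz: "\<And>t n. t \<in> {\<delta>..T} \<Longrightarrow> (\<Sum>i=1..n. real i powr (2 + \<beta>) * z t i) \<le> Q"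
  defines "L \<equiv> \<lambda>t. \<Sum>i=1..N. real i * \<bar>w t i - z t i\<bar>"
  shows "exp (- (4 * A * C * (T - \<delta>))) * L T \<le> L \<delta> + 24 * A * Q\<^sup>2 / N * (T - \<delta>)"
proof -
  define K where "K = 4 * A * C"
  define E where "E = 24 * A * Q\<^sup>2 / N"
  define \<phi> where "\<phi> t = exp (- (K * (t - \<delta>))) * L t" for t
  have K0: "0 \<le> K" using A_pos \<open>C \<ge> 0\<close> by (simp add: K_def)
  have E0: "0 \<le> E" using A_pos by (simp add: E_def)
  have L0: "0 \<le> L t" for t by (simp add: L_def sum_nonneg)
  have cw: "continuous_on {\<delta>..T} (\<lambda>t. w t i)" and cz: "continuous_on {\<delta>..T} (\<lambda>t. z t i)" for i
    using w z \<open>0 < \<delta>\<close> by (auto intro!: evolution_continuous)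
  have cL: "continuous_on {\<delta>..T} L"
    unfolding L_def by (intro continuous_intros cw cz)
  have bound: "\<phi> T - \<phi> \<delta> \<le> (E + \<epsilon>) * (T - \<delta>)" if "\<epsilon> > 0" for \<epsilon>
  proof (rule left_Dini_bound)
    show "continuous_on {\<delta>..T} \<phi>" unfolding \<phi>_def by (intro continuous_intros cL)
    fix t assume t: "\<delta> < t" "t \<le> T"
    \<comment> \<open>The signs are frozen at the right end point \<open>t\<close>, so \<open>h\<close> is continuous although the signs of the
difference may jump.\<close>
    define \<sigma> where "\<sigma> i = sgn (w t i - z t i)" for i
    define h where "h \<tau> = (\<Sum>i=1..N. real i * \<sigma> i * (rate_trunc a B N i (w \<tau>) - rate_trunc a B N i (z \<tau>)))" for \<tau>
    have ch: "continuous_on {\<delta>..T} h"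
      unfolding h_def rate_trunc_def gain_trunc_def loss_trunc_def case_prod_unfold
      by (intro continuous_intros cw cz)
    have ht: "h t \<le> K * L t"
      unfolding h_def K_def L_def
    proof (rule truncated_rate_difference_le)
      show "\<bar>\<sigma> i\<bar> \<le> 1" for i by (simp add: \<sigma>_def sgn_real_def)
      show "\<sigma> i * (w t i - z t i) = \<bar>w t i - z t i\<bar>" for i by (simp add: \<sigma>_def sgn_real_def)
    qed (use t \<open>0 < \<delta>\<close> w z Cw Cz evolution_nonneg in auto)
    have "t \<in> {\<delta>..T}" using t by auto
    then obtain \<eta>1 where \<eta>1: "\<eta>1 > 0" "\<And>\<tau>. \<tau> \<in> {\<delta>..T} \<Longrightarrow> dist \<tau> t < \<eta>1 \<Longrightarrow> dist (h \<tau>) (h t) < \<epsilon> / 2"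
      using ch \<open>\<epsilon> > 0\<close> unfolding continuous_on_iff by (meson half_gt_zero)
    have "continuous_on {\<delta>..T} (\<lambda>s. K * L s)" by (intro continuous_intros cL)
    then obtain \<eta>2 where \<eta>2: "\<eta>2 > 0" "\<And>\<tau>. \<tau> \<in> {\<delta>..T} \<Longrightarrow> dist \<tau> t < \<eta>2 \<Longrightarrow> dist (K * L \<tau>) (K * L t) < \<epsilon> / 2"
      using \<open>t \<in> {\<delta>..T}\<close> \<open>\<epsilon> > 0\<close> unfolding continuous_on_iff by (meson half_gt_zero)
    have "\<phi> t - \<phi> s \<le> (E + \<epsilon>) * (t - s)" if s: "\<delta> \<le> s" "t - min \<eta>1 \<eta>2 < s" "s < t" for s
    proof -
      have L_diff: "L t - L s \<le> (K * L t + \<epsilon> / 2 + E) * (t - s)"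
      proof -
        have "L t - L s \<le> (\<Sum>i=1..N. real i * \<sigma> i * ((w t i - w s i) - (z t i - z s i)))"
          unfolding L_def sum_subtractf[symmetric]
        proof (rule sum_mono)
          fix i
          have "\<bar>w t i - z t i\<bar> = \<sigma> i * (w t i - z t i)" by (simp add: \<sigma>_def sgn_real_def)
          moreover have "\<sigma> i * (w s i - z s i) \<le> \<bar>w s i - z s i\<bar>" by (auto simp: \<sigma>_def sgn_real_def)
          ultimately have "\<bar>w t i - z t i\<bar> - \<bar>w s i - z s i\<bar> \<le> \<sigma> i * ((w t i - w s i) - (z t i - z s i))"
            by (simp add: algebra_simps)
          from mult_left_mono[OF this, of "real i"]
          show "real i * \<bar>w t i - z t i\<bar> - real i * \<bar>w s i - z s i\<bar> \<le> real i * \<sigma> i * ((w t i - w s i) - (z t i - z s i))"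
            by (simp add: right_diff_distrib mult.assoc)
        qed
        also have "\<dots> \<le> (K * L t + \<epsilon> / 2 + E) * (t - s)"
        proof (rule has_integral_le)
          show "((\<lambda>\<tau>. \<Sum>i=1..N. real i * \<sigma> i * (net_rate a B i (w \<tau>) - net_rate a B i (z \<tau>)))
              has_integral (\<Sum>i=1..N. real i * \<sigma> i * ((w t i - w s i) - (z t i - z s i)))) {s..t}"
            using w z s \<open>0 < \<delta>\<close>
            by (intro has_integral_sum has_integral_mult_right has_integral_diff) (auto simp: evolution_def)
          show "((\<lambda>\<tau>. K * L t + \<epsilon> / 2 + E) has_integral (K * L t + \<epsilon> / 2 + E) * (t - s)) {s..t}"
            using has_integral_const_real[of "K * L t + \<epsilon> / 2 + E" s t] s by (simp add: mult.commute)
          fix \<tau> assume \<tau>: "\<tau> \<in> {s..t}"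
          then have \<tau>I: "\<tau> \<in> {\<delta>..T}" using s t by auto
          have "\<tau> \<ge> 0" using \<tau>I \<open>0 < \<delta>\<close> by auto
          have "dist \<tau> t < \<eta>1" using \<tau> s by (auto simp: dist_real_def)
          from \<eta>1(2)[OF \<tau>I this] have "h \<tau> - h t < \<epsilon> / 2"
            unfolding dist_real_def using abs_ge_self[of "h \<tau> - h t"] by linarith
          then have "h \<tau> \<le> K * L t + \<epsilon> / 2" using ht by linarith
          moreover have "(\<Sum>i=1..N. real i * \<sigma> i * (net_rate a B i (w \<tau>) - net_rate a B i (z \<tau>))) \<le> h \<tau> + E"
          proof -
            let ?ew = "\<lambda>i. net_rate a B i (w \<tau>) - rate_trunc a B N i (w \<tau>)"
            let ?ez = "\<lambda>i. net_rate a B i (z \<tau>) - rate_trunc a B N i (z \<tau>)"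
            have "(\<Sum>i=1..N. real i * \<sigma> i * (net_rate a B i (w \<tau>) - net_rate a B i (z \<tau>))) - h \<tau>
                = (\<Sum>i=1..N. real i * (\<sigma> i * (?ew i - ?ez i)))"
              unfolding h_def sum_subtractf[symmetric] by (intro sum.cong refl) (simp add: algebra_simps)
            also have "\<dots> \<le> (\<Sum>i=1..N. real i * (\<bar>?ew i\<bar> + \<bar>?ez i\<bar>))"
              by (intro sum_mono mult_left_mono) (auto simp: \<sigma>_def sgn_real_def)
            also have "\<dots> = (\<Sum>i=1..N. real i * \<bar>?ew i\<bar>) + (\<Sum>i=1..N. real i * \<bar>?ez i\<bar>)"
              by (simp add: distrib_left sum.distrib)
            also have "\<dots> \<le> 12 * A * Q\<^sup>2 / N + 12 * A * Q\<^sup>2 / N"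
              using \<tau>I \<open>\<tau> \<ge> 0\<close> \<open>N \<ge> 1\<close> w z Qw Qz evolution_nonneg
              by (intro add_mono net_rate_trunc_error) auto
            also have "\<dots> = E" by (simp add: E_def)
            finally show ?thesis by simp
          qed
          ultimately show "(\<Sum>i=1..N. real i * \<sigma> i * (net_rate a B i (w \<tau>) - net_rate a B i (z \<tau>))) \<le> K * L t + \<epsilon> / 2 + E"
            by linarith
        qed
        finally show ?thesis .
      qed
      define c where "c = exp (- (K * (t - \<delta>)))"
      have c: "0 \<le> c" "c \<le> 1" using K0 t by (auto simp: c_def)
      \<comment> \<open>Convexity of the exponential: between \<open>s\<close> and \<open>t\<close> the weight drops by at least \<open>c K (t - s)\<close>.\<close>
      have "c * (1 + K * (t - s)) \<le> c * exp (K * (t - s))"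
        using c exp_ge_add_one_self by (intro mult_left_mono) auto
      also have "\<dots> = exp (- (K * (s - \<delta>)))"
        by (simp add: c_def exp_add[symmetric] algebra_simps)
      finally have "c * (1 + K * (t - s)) * L s \<le> exp (- (K * (s - \<delta>))) * L s"
        using L0 by (rule mult_right_mono)
      then have "\<phi> t - \<phi> s \<le> c * (L t - L s - K * (t - s) * L s)"
        by (simp add: \<phi>_def c_def algebra_simps)
      also have "\<dots> \<le> c * ((E + \<epsilon>) * (t - s))"
      proof (rule mult_left_mono)
        have "dist s t < \<eta>2" "s \<in> {\<delta>..T}" using s t by (auto simp: dist_real_def)
        then have "K * L t - K * L s \<le> \<epsilon> / 2" using \<eta>2(2)[of s] unfolding dist_real_def using abs_ge_minus_self[of "K * L s - K * L t"] by linarith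
        then have "(K * L t + \<epsilon> / 2 + E - K * L s) * (t - s) \<le> (E + \<epsilon>) * (t - s)"
          using s by (intro mult_right_mono) auto
        then show "L t - L s - K * (t - s) * L s \<le> (E + \<epsilon>) * (t - s)"
          using L_diff by (simp add: algebra_simps)
      qed (rule c)
      also have "\<dots> \<le> 1 * ((E + \<epsilon>) * (t - s))"
        using c E0 \<open>\<epsilon> > 0\<close> s by (intro mult_right_mono) auto
      finally show ?thesis by simp
    qed
    then show "\<exists>\<eta>>0. \<forall>s. \<delta> \<le> s \<and> t - \<eta> < s \<and> s < t \<longrightarrow> \<phi> t - \<phi> s \<le> (E + \<epsilon>) * (t - s)"
      using \<eta>1(1) \<eta>2(1) by (intro exI[of _ "min \<eta>1 \<eta>2"]) auto
  qed fact
  have "\<phi> T - \<phi> \<delta> - E * (T - \<delta>) \<le> 0"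
  proof (rule field_le_epsilon)
    fix e :: real assume "e > 0"
    define \<epsilon> where "\<epsilon> = e / (T - \<delta> + 1)"
    have "\<epsilon> > 0" using \<open>e > 0\<close> \<open>\<delta> \<le> T\<close> by (simp add: \<epsilon>_def)
    moreover have "\<epsilon> * (T - \<delta>) \<le> \<epsilon> * (T - \<delta> + 1)" using \<open>\<epsilon> > 0\<close> by (intro mult_left_mono) auto
    moreover have "\<epsilon> * (T - \<delta> + 1) = e" using \<open>\<delta> \<le> T\<close> by (simp add: \<epsilon>_def)
    ultimately show "\<phi> T - \<phi> \<delta> - E * (T - \<delta>) \<le> 0 + e" using bound[of \<epsilon>] by (simp add: algebra_simps)
  qed
  then show ?thesis by (simp add: \<phi>_def K_def E_def)
qed

text \<open>The moment of order \<open>1 + \<beta>\<close> makes the tails of the norm of \<open>Y\<^sub>1\<close> of order \<open>N\<close> to the power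
\<open>-\<beta>\<close>, uniformly over all sequences with the same bound.\<close>

lemma distY1_le_truncation:
  assumes y: "\<And>i. i \<ge> 1 \<Longrightarrow> 0 \<le> y i" and z: "\<And>i. i \<ge> 1 \<Longrightarrow> 0 \<le> z i"
    and "M (1 + \<beta>) y \<le> ennreal C" "M (1 + \<beta>) z \<le> ennreal C" "0 \<le> C" "N \<ge> 1"
  shows "distY 1 y z \<le> (\<Sum>i=1..N. real i * \<bar>y i - z i\<bar>) + 2 * C * real N powr - \<beta>"
proof (rule distY1_le)
  fix n
  have Cy: "(\<Sum>i=1..n. real i powr (1 + \<beta>) * y i) \<le> C" and Cz: "(\<Sum>i=1..n. real i powr (1 + \<beta>) * z i) \<le> C"
    using moment_le_iff[of y C "1 + \<beta>"] moment_le_iff[of z C "1 + \<beta>"] assms by auto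
  have "(\<Sum>i=1..n. real i * \<bar>y i - z i\<bar>) \<le> (\<Sum>i\<in>{1..N} \<union> {N+1..n}. real i * \<bar>y i - z i\<bar>)"
    by (intro sum_mono2) auto
  also have "\<dots> = (\<Sum>i=1..N. real i * \<bar>y i - z i\<bar>) + (\<Sum>i=N+1..n. real i * \<bar>y i - z i\<bar>)"
    by (intro sum.union_disjoint) auto
  also have "(\<Sum>i=N+1..n. real i * \<bar>y i - z i\<bar>)
      \<le> (\<Sum>i=N+1..n. real N powr - \<beta> * (real i powr (1 + \<beta>) * y i + real i powr (1 + \<beta>) * z i))"
  proof (rule sum_mono)
    fix i assume i: "i \<in> {N+1..n}"
    have "real N powr \<beta> \<le> real i powr \<beta>" using i \<beta>_pos by (intro powr_mono2) auto
    then have "1 \<le> real N powr - \<beta> * real i powr \<beta>"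
      using \<open>N \<ge> 1\<close> by (simp add: powr_minus field_simps)
    then have "real i * 1 \<le> real i * (real N powr - \<beta> * real i powr \<beta>)" by (intro mult_left_mono) auto
    also have "\<dots> = real N powr - \<beta> * real i powr (1 + \<beta>)" using i by (simp add: powr_add)
    finally have "real i \<le> real N powr - \<beta> * real i powr (1 + \<beta>)" by simp
    moreover have "\<bar>y i - z i\<bar> \<le> y i + z i" using y[of i] z[of i] i by auto
    ultimately have "real i * \<bar>y i - z i\<bar> \<le> (real N powr - \<beta> * real i powr (1 + \<beta>)) * (y i + z i)"
      by (intro mult_mono) auto
    then show "real i * \<bar>y i - z i\<bar> \<le> real N powr - \<beta> * (real i powr (1 + \<beta>) * y i + real i powr (1 + \<beta>) * z i)"
      by (simp add: algebra_simps)
  qed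
  also have "\<dots> = real N powr - \<beta> * (\<Sum>i=N+1..n. real i powr (1 + \<beta>) * y i + real i powr (1 + \<beta>) * z i)"
    by (simp add: sum_distrib_left)
  also have "\<dots> \<le> real N powr - \<beta> * (\<Sum>i=1..n. real i powr (1 + \<beta>) * y i + real i powr (1 + \<beta>) * z i)"
    using y z by (intro mult_left_mono sum_mono2) auto
  also have "\<dots> \<le> real N powr - \<beta> * (C + C)"
    using Cy Cz by (intro mult_left_mono) (auto simp: sum.distrib)
  finally show "(\<Sum>i=1..n. real i * \<bar>y i - z i\<bar>) \<le> (\<Sum>i=1..N. real i * \<bar>y i - z i\<bar>) + 2 * C * real N powr - \<beta>"
    by (simp add: mult_ac)
qed

text \<open>Continuous coordinates and uniformly small tails.\<close>

lemma regular_evolution_continuous_in_Y1: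
  assumes w: "regular_evolution C w" and "0 \<le> C" "0 \<le> t"
  shows "((\<lambda>s. distY 1 (w s) (w t)) \<longlongrightarrow> 0) (at t within {0..})"
proof (rule order_tendstoI)
  fix e :: real assume "0 < e"
  have ev: "evolution w" and C: "M (1 + \<beta>) (w s) \<le> ennreal C" if "s \<ge> 0" for s
    using w that by (auto simp: regular_evolution_def)
  have "(\<lambda>N. 2 * C * real N powr - \<beta>) \<longlonglongrightarrow> 2 * C * 0"
    using \<beta>_pos by (intro tendsto_intros tendsto_neg_powr filterlim_real_sequentially) auto
  then have "\<forall>\<^sub>F N in sequentially. 2 * C * real N powr - \<beta> < e / 2"
    using \<open>0 < e\<close> by (intro order_tendstoD(2)) auto
  then obtain N where N: "N \<ge> 1" "2 * C * real N powr - \<beta> < e / 2"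
    using eventually_conj[OF _ eventually_ge_at_top[of 1]] eventually_happens' sequentially_bot by blast
  have "((\<lambda>s. \<Sum>i=1..N. real i * \<bar>w s i - w t i\<bar>) \<longlongrightarrow> (\<Sum>i=1..N. real i * \<bar>w t i - w t i\<bar>)) (at t within {0..})"
    using evolution_continuous[OF ev[OF \<open>0 \<le> t\<close>] order_refl] \<open>0 \<le> t\<close>
    by (intro tendsto_intros) (auto simp: continuous_on_def)
  then have "\<forall>\<^sub>F s in at t within {0..}. (\<Sum>i=1..N. real i * \<bar>w s i - w t i\<bar>) < e / 2"
    using \<open>0 < e\<close> by (intro order_tendstoD(2)) auto
  moreover have "\<forall>\<^sub>F s in at t within {0..}. s \<ge> 0" by (simp add: eventually_at_filter)
  ultimately show "\<forall>\<^sub>F s in at t within {0..}. distY 1 (w s) (w t) < e"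
  proof eventually_elim
    case (elim s)
    have "distY 1 (w s) (w t) \<le> (\<Sum>i=1..N. real i * \<bar>w s i - w t i\<bar>) + 2 * C * real N powr - \<beta>"
      using ev evolution_nonneg C elim \<open>0 \<le> t\<close> \<open>0 \<le> C\<close> N by (intro distY1_le_truncation) auto
    then show ?case using elim N by linarith
  qed
next
  fix e :: real assume "e < 0"
  then show "\<forall>\<^sub>F s in at t within {0..}. e < distY 1 (w s) (w t)"
    using distY_nonneg by (intro always_eventually allI) (rule less_le_trans)
qed

text \<open>The truncation error in \<open>distance_growth_truncated\<close> involves a bound on the moment of order \<open>2 + \<beta>\<close>
that may blow up as \<open>\<delta>\<close> tends to \<open>0\<close>. It disappears for fixed \<open>\<delta>\<close> as \<open>N\<close> tends to
infinity; then continuity in \<open>Y\<^sub>1\<close> at time \<open>0\<close> allows \<open>\<delta>\<close> to tend to \<open>0\<close>.\<close>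

lemma regular_evolution_stability:
  assumes w: "regular_evolution C w" and z: "regular_evolution C z" and "0 \<le> C" "0 \<le> t"
  shows "distY 1 (w t) (z t) \<le> exp (4 * A * C * t) * distY 1 (w 0) (z 0)"
proof (cases "t = 0")
  case False
  then have t: "t > 0" using \<open>0 \<le> t\<close> by simp
  have ev: "evolution w" "evolution z" using w z by (auto simp: regular_evolution_def)
  have C: "(\<Sum>i=1..n. real i powr (1 + \<beta>) * w s i) \<le> C" "(\<Sum>i=1..n. real i powr (1 + \<beta>) * z s i) \<le> C"
    if "s \<ge> 0" for s n
    using w z that \<open>0 \<le> C\<close> moment_le_iff[of "w s" C "1 + \<beta>"] moment_le_iff[of "z s" C "1 + \<beta>"]
    by (auto simp: regular_evolution_def evolution_def)
  have inY: "w s \<in> Y 1" "z s \<in> Y 1" if "s \<ge> 0" for s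
    using regular_evolution_in_Y[OF w that] regular_evolution_in_Y[OF z that] .
  have from_\<delta>: "distY 1 (w t) (z t) \<le> exp (4 * A * C * t) * distY 1 (w \<delta>) (z \<delta>)" if \<delta>: "0 < \<delta>" "\<delta> < t" for \<delta>
  proof (rule distY1_le)
    fix n
    obtain Q1 where Q1: "Q1 \<ge> 0" "\<And>s. s \<ge> \<delta> \<Longrightarrow> M (2 + \<beta>) (w s) \<le> ennreal Q1"
      using w \<delta> unfolding regular_evolution_def by meson
    obtain Q2 where Q2: "Q2 \<ge> 0" "\<And>s. s \<ge> \<delta> \<Longrightarrow> M (2 + \<beta>) (z s) \<le> ennreal Q2"
      using z \<delta> unfolding regular_evolution_def by meson
    define Q where "Q = max Q1 Q2"
    have Q: "(\<Sum>i=1..n. real i powr (2 + \<beta>) * w s i) \<le> Q" "(\<Sum>i=1..n. real i powr (2 + \<beta>) * z s i) \<le> Q"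
      if "s \<ge> \<delta>" for s n
      using moment_le_iff[of "w s" Q1 "2 + \<beta>"] moment_le_iff[of "z s" Q2 "2 + \<beta>"] Q1 Q2 that ev \<delta>
      by (auto simp: evolution_def Q_def le_max_iff_disj)
    define d where "d = distY 1 (w \<delta>) (z \<delta>)"
    have "(\<Sum>i=1..n. real i * \<bar>w t i - z t i\<bar>) \<le> exp (4 * A * C * t) * (d + 24 * A * Q\<^sup>2 / N * t)"
      if "N \<ge> max n 1" for N
    proof -
      let ?L = "\<lambda>s. \<Sum>i=1..N. real i * \<bar>w s i - z s i\<bar>"
      have "exp (- (4 * A * C * (t - \<delta>))) * ?L t \<le> ?L \<delta> + 24 * A * Q\<^sup>2 / N * (t - \<delta>)"
        using \<delta> that C Q \<open>0 \<le> C\<close> by (intro distance_growth_truncated ev) auto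
      also have "\<dots> \<le> d + 24 * A * Q\<^sup>2 / N * t"
        unfolding d_def using \<delta> inY A_pos by (intro add_mono partial_sum_le_distY1 mult_left_mono) auto
      finally have "exp (4 * A * C * t) * (exp (- (4 * A * C * (t - \<delta>))) * ?L t)
          \<le> exp (4 * A * C * t) * (d + 24 * A * Q\<^sup>2 / N * t)"
        by (intro mult_left_mono) auto
      moreover have "exp (4 * A * C * t) * (exp (- (4 * A * C * (t - \<delta>))) * ?L t) = exp (4 * A * C * \<delta>) * ?L t"
        unfolding mult.assoc[symmetric] exp_add[symmetric] by (simp add: algebra_simps)
      moreover have "1 * ?L t \<le> exp (4 * A * C * \<delta>) * ?L t"
        using A_pos \<open>0 \<le> C\<close> \<delta> by (intro mult_right_mono sum_nonneg) auto
      moreover have "(\<Sum>i=1..n. real i * \<bar>w t i - z t i\<bar>) \<le> ?L t"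
        using that by (intro sum_mono2) auto
      ultimately show ?thesis by linarith
    qed
    moreover have "(\<lambda>N. exp (4 * A * C * t) * (d + 24 * A * Q\<^sup>2 / real N * t)) \<longlonglongrightarrow> exp (4 * A * C * t) * (d + 0 * t)"
      by (intro tendsto_intros real_tendsto_divide_at_top filterlim_real_sequentially)
    ultimately have "(\<Sum>i=1..n. real i * \<bar>w t i - z t i\<bar>) \<le> exp (4 * A * C * t) * (d + 0 * t)"
      by (intro LIMSEQ_le_const) blast+
    then show "(\<Sum>i=1..n. real i * \<bar>w t i - z t i\<bar>) \<le> exp (4 * A * C * t) * distY 1 (w \<delta>) (z \<delta>)"
      by (simp add: d_def)
  qed
  let ?E = "exp (4 * A * C * t)"
  let ?F = "at (0::real) within {0..}"
  have "((\<lambda>\<delta>. ?E * (distY 1 (w \<delta>) (w 0) + distY 1 (w 0) (z 0) + distY 1 (z \<delta>) (z 0)))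
      \<longlongrightarrow> ?E * (0 + distY 1 (w 0) (z 0) + 0)) ?F"
    by (intro tendsto_intros regular_evolution_continuous_in_Y1[OF w \<open>0 \<le> C\<close>] regular_evolution_continuous_in_Y1[OF z \<open>0 \<le> C\<close>]) auto
  moreover have "\<forall>\<^sub>F \<delta> in ?F. distY 1 (w t) (z t)
      \<le> ?E * (distY 1 (w \<delta>) (w 0) + distY 1 (w 0) (z 0) + distY 1 (z \<delta>) (z 0))"
  proof -
    have "\<forall>\<^sub>F \<delta> in ?F. \<delta> < t" using t by (intro order_tendstoD(2)[OF tendsto_ident_at])
    moreover have "\<forall>\<^sub>F \<delta> in ?F. \<delta> > 0" by (auto simp: eventually_at_filter)
    ultimately show ?thesis
    proof eventually_elim
      case (elim \<delta>)
      have "distY 1 (w \<delta>) (z \<delta>) \<le> distY 1 (w \<delta>) (w 0) + distY 1 (w 0) (z \<delta>)"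
        using elim by (intro distY_triangle inY) auto
      also have "distY 1 (w 0) (z \<delta>) \<le> distY 1 (w 0) (z 0) + distY 1 (z 0) (z \<delta>)"
        using elim by (intro distY_triangle inY) auto
      finally have "?E * distY 1 (w \<delta>) (z \<delta>) \<le> ?E * (distY 1 (w \<delta>) (w 0) + distY 1 (w 0) (z 0) + distY 1 (z \<delta>) (z 0))"
        by (intro mult_left_mono) (auto simp: distY_commute[of 1 "z 0"])
      with from_\<delta>[of \<delta>] elim show ?case by linarith
    qed
  qed
  moreover have "?F \<noteq> bot" by (simp add: at_within_Ici_at_right)
  ultimately show ?thesis using tendsto_lowerbound[of _ _ ?F] by fastforce
qed simp

lemma regular_evolution_unique:
  assumes "regular_evolution C w" "regular_evolution C z" "0 \<le> C" "w 0 = z 0" "0 \<le> t"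
  shows "w t = z t"
proof -
  have in_Y: "w t \<in> Y 1" "z t \<in> Y 1" "z 0 \<in> Y 1"
    using regular_evolution_in_Y assms by blast+
  then have "distY 1 (w 0) (z 0) = 0"
    using Metric_space.zero[OF Metric_space_Y[of 1]] \<open>w 0 = z 0\<close> by simp
  then have "distY 1 (w t) (z t) = 0"
    using regular_evolution_stability[OF assms(1-3) \<open>0 \<le> t\<close>] distY_nonneg[of 1 "w t" "z t"] by simp
  then show ?thesis using Metric_space.zero[OF Metric_space_Y] in_Y by blast
qed

lemma regular_evolution_shift:
  fixes s :: real
  assumes w: "regular_evolution C w" and "s \<ge> 0"
  shows "regular_evolution C (\<lambda>t. w (t + s))"
proof -
  have ev: "evolution w" using w by (simp add: regular_evolution_def)
  have "evolution (\<lambda>t. w (t + s))"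
    unfolding evolution_def
  proof (intro conjI allI impI)
    show "continuous_on {0..} (\<lambda>t. w (t + s) i)" for i
      using \<open>s \<ge> 0\<close>
      by (intro continuous_on_compose2[OF evolution_continuous[OF ev order_refl]] continuous_intros) auto
    fix i :: nat and u t :: real assume "1 \<le> i" "0 < u \<and> u \<le> t"
    then have "((\<lambda>\<tau>. net_rate a B i (w \<tau>)) has_integral (w (t + s) i - w (u + s) i)) {u + s..t + s}"
      using ev \<open>s \<ge> 0\<close> by (auto simp: evolution_def)
    then show "((\<lambda>\<tau>. net_rate a B i (w (\<tau> + s))) has_integral (w (t + s) i - w (u + s) i)) {u..t}"
      using has_integral_shift_Icc_real[of "\<lambda>\<tau>. net_rate a B i (w \<tau>)" s _ u t] by (simp add: o_def add.commute)
  qed (use ev \<open>s \<ge> 0\<close> in \<open>auto simp: evolution_def\<close>)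
  moreover have "\<exists>Q\<ge>0. \<forall>t\<ge>\<delta>. M (2 + \<beta>) (w (t + s)) \<le> ennreal Q" if "\<delta> > 0" for \<delta>
  proof -
    obtain Q where "Q \<ge> 0" "\<And>t. t \<ge> \<delta> \<Longrightarrow> M (2 + \<beta>) (w t) \<le> ennreal Q"
      using w \<open>\<delta> > 0\<close> unfolding regular_evolution_def by meson
    then show ?thesis using \<open>s \<ge> 0\<close> by (intro exI[of _ Q]) auto
  qed
  ultimately show ?thesis using w \<open>s \<ge> 0\<close> by (auto simp: regular_evolution_def)
qed

end

section \<open>Solutions as evolutions\<close>

text \<open>A solution is assumed to have integrable collision rates; since its coordinates are continuous, the
loss is then integrable as well.\<close>

lemma loss_eq_mult_coll_rate:
  assumes "0 \<le> y i"
  shows "loss a i y = ennreal (y i) * coll_rate a i y"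
proof (rule LIMSEQ_unique)
  show "(\<lambda>n. \<Sum>j\<in>{1..} \<inter> {..n}. ennreal (a i j * y i * y j)) \<longlonglongrightarrow> loss a i y"
    unfolding loss_def by (rule ennreal_partial_sums_tendsto)
  have "(\<lambda>n. ennreal (y i) * (\<Sum>j\<in>{1..} \<inter> {..n}. ennreal (a i j * y j)))
      \<longlonglongrightarrow> ennreal (y i) * coll_rate a i y"
    unfolding coll_rate_def by (intro ennreal_tendsto_cmult ennreal_partial_sums_tendsto) simp
  then show "(\<lambda>n. \<Sum>j\<in>{1..} \<inter> {..n}. ennreal (a i j * y i * y j)) \<longlonglongrightarrow> ennreal (y i) * coll_rate a i y"
    using assms by (simp add: sum_distrib_left ennreal_mult'[symmetric] mult_ac)
qed

lemma in_L1_imp_integrable: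
  assumes "in_L1 t f"
  shows "integrable (lebesgue_on {0<..<t}) (\<lambda>\<tau>. enn2real (f \<tau>))"
proof (rule integrableI_bounded)
  have meas: "f \<in> borel_measurable (lebesgue_on {0<..<t})"
    and fin: "(\<integral>\<^sup>+\<tau>. f \<tau> \<partial>lebesgue_on {0<..<t}) < \<infinity>"
    using assms by (auto simp: in_L1_def)
  show "(\<lambda>\<tau>. enn2real (f \<tau>)) \<in> borel_measurable (lebesgue_on {0<..<t})"
    using meas by (rule borel_measurable_enn2real)
  have "ennreal (norm (enn2real x)) \<le> x" for x by (cases x) auto
  then have "(\<integral>\<^sup>+\<tau>. ennreal (norm (enn2real (f \<tau>))) \<partial>lebesgue_on {0<..<t}) \<le> (\<integral>\<^sup>+\<tau>. f \<tau> \<partial>lebesgue_on {0<..<t})"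
    by (intro nn_integral_mono)
  with fin show "(\<integral>\<^sup>+\<tau>. ennreal (norm (enn2real (f \<tau>))) \<partial>lebesgue_on {0<..<t}) < \<infinity>"
    by (rule le_less_trans[rotated])
qed

lemma continuous_on_Ici_if_Ico:
  fixes f :: "real \<Rightarrow> real"
  assumes "\<And>t. t > 0 \<Longrightarrow> continuous_on {0..<t} f"
  shows "continuous_on {0..} f"
  unfolding continuous_on_def
proof
  fix x :: real assume x: "x \<in> {0..}"
  then have "(f \<longlongrightarrow> f x) (at x within {0..<x+1})"
    using assms[of "x + 1"] by (auto simp: continuous_on_def)
  moreover have "at x within {0..<x+1} = at x within {0..}"
    by (rule at_within_nhd[where S = "{..<x+1}"]) auto
  ultimately show "(f \<longlongrightarrow> f x) (at x within {0..})" by simp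
qed

context collision_breakage
begin

text \<open>Stated with the gauge integral, whose lemmas on subintervals and indefinite integrals give the
increments and the initial value.\<close>

lemma cib_solution_integral_equation:
  assumes sol: "cib_solution a B \<infinity> win w" and "i \<ge> 1" "t > 0"
  shows "((\<lambda>\<tau>. net_rate a B i (w \<tau>)) has_integral (w t i - win i)) {0..t}"
proof -
  let ?I = "lebesgue_on {0<..<t}"
  have nonneg: "0 \<le> w \<tau> i" if "\<tau> \<ge> 0" for \<tau>
    using sol that \<open>i \<ge> 1\<close> by (auto simp: cib_solution_def)
  have L1: "in_L1 t (\<lambda>\<tau>. coll_rate a i (w \<tau>))" "in_L1 t (\<lambda>\<tau>. gain a B i (w \<tau>))"
    and eq: "w t i = win i + (LINT \<tau>|?I. net_rate a B i (w \<tau>))"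
    using sol \<open>i \<ge> 1\<close> \<open>t > 0\<close> by (auto simp: cib_solution_def net_rate_def)
  have "continuous_on {0..<t+1} (\<lambda>\<tau>. w \<tau> i)"
    using sol \<open>i \<ge> 1\<close> \<open>t > 0\<close> by (auto simp: cib_solution_def)
  then have cont: "continuous_on {0..t} (\<lambda>\<tau>. w \<tau> i)"
    by (rule continuous_on_subset) auto
  then have "bounded ((\<lambda>\<tau>. w \<tau> i) ` {0..t})"
    by (intro compact_imp_bounded compact_continuous_image) auto
  then obtain K where K: "\<And>\<tau>. \<tau> \<in> {0..t} \<Longrightarrow> \<bar>w \<tau> i\<bar> \<le> K"
    unfolding bounded_iff by (metis imageI real_norm_def)
  have "integrable ?I (\<lambda>\<tau>. w \<tau> i * enn2real (coll_rate a i (w \<tau>)))"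
  proof (rule Bochner_Integration.integrable_bound)
    show "integrable ?I (\<lambda>\<tau>. K * enn2real (coll_rate a i (w \<tau>)))"
      by (intro integrable_mult_right in_L1_imp_integrable L1)
    have "continuous_on {0<..<t} (\<lambda>\<tau>. w \<tau> i)"
      using cont by (rule continuous_on_subset) auto
    then show "(\<lambda>\<tau>. w \<tau> i * enn2real (coll_rate a i (w \<tau>))) \<in> borel_measurable ?I"
      by (intro borel_measurable_times continuous_imp_measurable_on_sets_lebesgue
          borel_measurable_integrable[OF in_L1_imp_integrable[OF L1(1)]]) auto
    show "AE \<tau> in ?I. norm (w \<tau> i * enn2real (coll_rate a i (w \<tau>))) \<le> norm (K * enn2real (coll_rate a i (w \<tau>)))"
    proof (rule AE_I2)
      fix \<tau> assume "\<tau> \<in> space ?I"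
      then have "\<tau> \<in> {0..t}" by auto
      from K[OF this] show "norm (w \<tau> i * enn2real (coll_rate a i (w \<tau>))) \<le> norm (K * enn2real (coll_rate a i (w \<tau>)))"
        by (auto simp: abs_mult intro!: mult_right_mono)
    qed
  qed
  then have "integrable ?I (\<lambda>\<tau>. enn2real (loss a i (w \<tau>)))"
  proof (rule Bochner_Integration.integrable_cong[THEN iffD1, rotated 2])
    fix \<tau> assume "\<tau> \<in> space ?I"
    then show "w \<tau> i * enn2real (coll_rate a i (w \<tau>)) = enn2real (loss a i (w \<tau>))"
      using nonneg by (simp add: loss_eq_mult_coll_rate enn2real_mult)
  qed simp
  then have int: "integrable ?I (\<lambda>\<tau>. net_rate a B i (w \<tau>))"
    unfolding net_rate_def
    by (intro Bochner_Integration.integrable_diff integrable_mult_right in_L1_imp_integrable[OF L1(2)])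
  have "((\<lambda>\<tau>. net_rate a B i (w \<tau>)) has_integral (w t i - win i)) {0<..<t}"
    using has_integral_integral_lebesgue_on[OF int] eq by simp
  then show ?thesis by (simp add: has_integral_Icc_iff_Ioo)
qed

text \<open>The integral equation says nothing at \<open>t = 0\<close>, but its right-hand side tends to the initial
condition there and the solution is continuous.\<close>

lemma cib_solution_evolution:
  assumes sol: "cib_solution a B \<infinity> win w"
  shows "evolution w" and "w 0 = win"
proof -
  have nonneg: "w t 0 = 0" "i \<ge> 1 \<Longrightarrow> 0 \<le> w t i" if "t \<ge> 0" for t i
    using sol that by (auto simp: cib_solution_def)
  have cont: "continuous_on {0..} (\<lambda>t. w t i)" for i
  proof (cases "i = 0")
    case True
    have "continuous_on {0..} (\<lambda>t. w t i) \<longleftrightarrow> continuous_on {0..} (\<lambda>t::real. 0::real)"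
      using True nonneg(1) by (intro continuous_on_cong) auto
    then show ?thesis by simp
  next
    case False
    then show ?thesis using sol by (intro continuous_on_Ici_if_Ico) (auto simp: cib_solution_def)
  qed
  note int = cib_solution_integral_equation[OF sol]
  show "evolution w"
    unfolding evolution_def
  proof (intro conjI allI impI)
    fix i s t assume i: "1 \<le> (i::nat)" and st: "0 < s \<and> s \<le> (t::real)"
    let ?h = "\<lambda>\<tau>. net_rate a B i (w \<tau>)"
    have ti: "?h integrable_on {0..t}" using int[OF i, of t] st by (auto simp: integrable_on_def)
    have "integral {0..s} ?h + integral {s..t} ?h = integral {0..t} ?h"
      using st ti by (intro Henstock_Kurzweil_Integration.integral_combine) auto
    moreover have "integral {0..s} ?h = w s i - win i" "integral {0..t} ?h = w t i - win i"
      using int[OF i, of s] int[OF i, of t] st by (auto intro: integral_unique)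
    ultimately have "integral {s..t} ?h = w t i - w s i" by simp
    moreover have "?h integrable_on {s..t}" using ti st by (auto intro: integrable_subinterval_real)
    ultimately show "(?h has_integral (w t i - w s i)) {s..t}" by (metis integrable_integral)
  qed (use nonneg cont in auto)
  show "w 0 = win"
  proof
    fix i
    show "w 0 i = win i"
    proof (cases "i = 0")
      case True
      then show ?thesis using nonneg(1)[of 0] sol by (auto simp: cib_solution_def Ypos_def Y_def)
    next
      case False
      then have i: "i \<ge> 1" by simp
      let ?h = "\<lambda>\<tau>. net_rate a B i (w \<tau>)"
      let ?F = "at (0::real) within {0..1}"
      have "?h integrable_on {0..1}" using int[OF i, of 1] by (auto simp: integrable_on_def)
      then have "continuous_on {0..1} (\<lambda>t. win i + integral {0..t} ?h)"
        by (intro continuous_intros indefinite_integral_continuous_1)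
      then have "((\<lambda>t. win i + integral {0..t} ?h) \<longlongrightarrow> win i + integral {0..0} ?h) ?F"
        unfolding continuous_on_def by (rule bspec) simp
      moreover have "win i + integral {0..t} ?h = w t i" if "t > 0" for t
        using integral_unique[OF int[OF i that]] by simp
      then have "\<forall>\<^sub>F t in ?F. win i + integral {0..t} ?h = w t i"
        by (auto simp: eventually_at_filter intro!: always_eventually)
      ultimately have "((\<lambda>t. w t i) \<longlongrightarrow> win i) ?F"
        by (auto intro: Lim_transform_eventually)
      moreover have "continuous_on {0..1} (\<lambda>t. w t i)" using cont by (rule continuous_on_subset) auto
      then have "((\<lambda>t. w t i) \<longlongrightarrow> w 0 i) ?F" by (auto simp: continuous_on_def)
      moreover have "?F \<noteq> bot" by (simp add: at_within_Icc_at_right)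
      ultimately show ?thesis using tendsto_unique by blast
    qed
  qed
qed

end

section \<open>Measurability of sequence-valued functions\<close>

text \<open>By induction on the number of coordinates, since a finite combination of simple functions is simple.\<close>

lemma simple_function_restricted_sequence:
  fixes n :: nat
  assumes "\<And>i. simple_function N (\<lambda>t. f t i)"
  shows "simple_function N (\<lambda>t i. if 1 \<le> i \<and> i \<le> n then f t i else (0::real))"
proof (induction n)
  case 0
  have "(\<lambda>t i. if 1 \<le> i \<and> i \<le> 0 then f t i else 0) = (\<lambda>t (i::nat). 0::real)"
    by (auto simp: fun_eq_iff)
  then show ?case by simp
next
  case (Suc n)
  have "simple_function N (\<lambda>t. (\<lambda>i. if 1 \<le> i \<and> i \<le> n then f t i else 0)(Suc n := f t (Suc n)))"
    by (intro simple_function_compose2[OF Suc assms])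
  moreover have "(\<lambda>i. if 1 \<le> i \<and> i \<le> n then f t i else 0)(Suc n := f t (Suc n))
      = (\<lambda>i. if 1 \<le> i \<and> i \<le> Suc n then f t i else 0)" for t
    by (auto simp: fun_eq_iff)
  ultimately show ?case by simp
qed

lemma distY_tendsto_0_dominated:
  assumes y: "y \<in> Y \<gamma>" and lim: "\<And>i. i \<ge> 1 \<Longrightarrow> (\<lambda>n. s n i) \<longlonglongrightarrow> y i"
    and dom: "\<And>n i. i \<ge> 1 \<Longrightarrow> \<bar>s n i\<bar> \<le> 2 * \<bar>y i\<bar>"
  shows "(\<lambda>n. distY \<gamma> (s n) y) \<longlonglongrightarrow> 0"
proof -
  let ?g = "\<lambda>i. real i powr \<gamma> * (3 * \<bar>y i\<bar>)"
  let ?d = "\<lambda>i n. real i powr \<gamma> * \<bar>s n i - y i\<bar>"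
  have UNIV: "infsum h {1..} = infsum h UNIV" "h summable_on {1..} \<longleftrightarrow> h summable_on UNIV"
    if "h 0 = 0" for h :: "nat \<Rightarrow> real"
  proof -
    have "h i = 0" if "i \<in> UNIV - {1..}" for i using \<open>h 0 = 0\<close> that by (cases i) auto
    then show "infsum h {1..} = infsum h UNIV" "h summable_on {1..} \<longleftrightarrow> h summable_on UNIV"
      by (intro infsum_cong_neutral summable_on_cong_neutral; simp)+
  qed
  have le: "norm (?d i n) \<le> ?g i" for i n
  proof (cases "i = 0")
    case False
    then have "\<bar>s n i - y i\<bar> \<le> 3 * \<bar>y i\<bar>" using dom[of i n] by linarith
    then show ?thesis by (simp add: abs_mult mult_left_mono)
  qed simp
  have "(\<lambda>i. 3 * (real i powr \<gamma> * \<bar>y i\<bar>)) summable_on {1..}"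
    using y by (intro summable_on_cmult_right) (simp add: Y_def)
  then have g: "?g summable_on UNIV" using UNIV(2)[of ?g] by (simp add: mult_ac)
  have "(\<lambda>n. \<Sum>i. ?d i n) \<longlonglongrightarrow> (\<Sum>i. 0)"
  proof (rule tannerys_theorem[THEN conjunct2, THEN conjunct2])
    show "summable ?g" using g by (rule summable_on_imp_summable)
    show "(\<lambda>n. ?d i n) \<longlonglongrightarrow> 0" for i
    proof (cases "i = 0")
      case False
      then have "(\<lambda>n. ?d i n) \<longlonglongrightarrow> real i powr \<gamma> * \<bar>y i - y i\<bar>"
        by (intro tendsto_intros lim) auto
      then show ?thesis by simp
    qed simp
    show "\<forall>\<^sub>F (i, n) in at_top \<times>\<^sub>F sequentially. norm (?d i n) \<le> ?g i"
      using le by (intro always_eventually) auto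
  qed simp
  moreover have "distY \<gamma> (s n) y = (\<Sum>i. ?d i n)" for n
  proof -
    have "(\<lambda>i. ?d i n) summable_on UNIV"
      using g by (rule summable_on_comparison_test) (use le[of _ n] in auto)
    then have "(\<lambda>i. ?d i n) sums infsum (\<lambda>i. ?d i n) UNIV"
      by (intro has_sum_imp_sums has_sum_infsum)
    then show ?thesis
      using UNIV(1)[of "\<lambda>i. ?d i n"] by (simp add: distY_def normY_def sums_iff)
  qed
  ultimately show ?thesis by simp
qed

text \<open>Approximate each coordinate by simple functions that are dominated by twice its absolute value,
and cut off at size \<open>n\<close>; dominated convergence of the series then gives convergence in norm.\<close>

lemma strongly_measurable_if_coordinates:
  assumes I: "I \<in> sets lebesgue" and w: "\<And>t. t \<in> I \<Longrightarrow> w t \<in> Y \<gamma>"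
    and meas: "\<And>i. (\<lambda>t. w t i) \<in> borel_measurable (lebesgue_on I)"
  shows "strongly_measurable_Y \<gamma> I w"
proof -
  have sp: "space (lebesgue_on I) = I" by (simp add: space_restrict_space)
  have "\<exists>F. \<forall>n. simple_function (lebesgue_on I) (F n) \<and>
      (\<forall>t\<in>I. (\<lambda>n. F n t) \<longlonglongrightarrow> w t i \<and> (\<forall>n. \<bar>F n t\<bar> \<le> 2 * \<bar>w t i\<bar>))" for i
    using borel_measurable_implies_sequence_metric[OF meas[of i], of 0] unfolding sp
    by (auto simp: dist_real_def)
  then obtain F where F: "\<And>i n. simple_function (lebesgue_on I) (F i n)"
      "\<And>i t. t \<in> I \<Longrightarrow> (\<lambda>n. F i n t) \<longlonglongrightarrow> w t i"
      "\<And>i t n. t \<in> I \<Longrightarrow> \<bar>F i n t\<bar> \<le> 2 * \<bar>w t i\<bar>"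
    by metis
  define s where "s n t i = (if 1 \<le> i \<and> i \<le> n then F i n t else 0)" for n t i
  have simple: "simple_function (lebesgue_on I) (s n)" for n
    using simple_function_restricted_sequence[of "lebesgue_on I" "\<lambda>t i. F i n t" n] F(1)
    by (simp add: s_def[abs_def])
  have in_Y: "s n t \<in> Y \<gamma>" for n t
  proof -
    have "(\<lambda>i. real i powr \<gamma> * \<bar>s n t i\<bar>) summable_on {1..n}" by (rule summable_on_finite) simp
    then have "(\<lambda>i. real i powr \<gamma> * \<bar>s n t i\<bar>) summable_on {1..}"
      by (rule summable_on_cong_neutral[THEN iffD1, rotated 3]) (auto simp: s_def)
    then show ?thesis by (simp add: Y_def s_def)
  qed
  have conv: "(\<lambda>n. distY \<gamma> (s n t) (w t)) \<longlonglongrightarrow> 0" if t: "t \<in> I" for t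
  proof (rule distY_tendsto_0_dominated[OF w[OF t]])
    fix i :: nat assume "i \<ge> 1"
    then have "\<forall>\<^sub>F n in sequentially. F i n t = s n t i"
      by (intro eventually_sequentiallyI[of i]) (simp add: s_def)
    with F(2)[OF t, of i] show "(\<lambda>n. s n t i) \<longlonglongrightarrow> w t i"
      by (rule Lim_transform_eventually)
    show "\<bar>s n t i\<bar> \<le> 2 * \<bar>w t i\<bar>" for n using F(3)[OF t, of i n] by (simp add: s_def)
  qed
  show ?thesis
    unfolding strongly_measurable_Y_def
    using simple in_Y conv w sp by (intro exI[of _ s]) (auto intro!: AE_I2)
qed

section \<open>Moment bounds along solutions\<close>

context collision_breakage
begin

lemma regular_evolution_mono:
  "regular_evolution C w \<Longrightarrow> C \<le> D \<Longrightarrow> regular_evolution D w"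
  unfolding regular_evolution_def by (auto intro: order_trans ennreal_leI)

text \<open>The bound in (P2) decreases in time, so its value at \<open>\<delta>\<close> serves for all later times.\<close>

lemma solution_regular_evolution:
  assumes sol: "cib_solution a B \<infinity> win w" and P2: "P2 \<beta> F win w" and F: "0 < F (2 + \<beta>) (M 1 win) (M 0 win)"
    and C: "\<And>t. t \<ge> 0 \<Longrightarrow> M (1 + \<beta>) (w t) \<le> ennreal C"
  shows "regular_evolution C w"
  unfolding regular_evolution_def
proof (intro conjI allI impI)
  fix \<delta> :: real assume "\<delta> > 0"
  let ?b = "\<lambda>t. F (2 + \<beta>) (M 1 win) (M 0 win) * (1 + 1 / t) powr ((2 + \<beta> - 1) / \<beta>)"
  have "M (2 + \<beta>) (w t) \<le> ennreal (?b \<delta>)" if "t \<ge> \<delta>" for t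
  proof -
    have "M (2 + \<beta>) (w t) \<le> ennreal (?b t)"
      using P2[unfolded P2_def, rule_format, of "2 + \<beta>" t] \<beta>_pos \<open>\<delta> > 0\<close> that by simp
    also have "\<dots> \<le> ennreal (?b \<delta>)"
      using that \<open>\<delta> > 0\<close> \<beta>_pos F
      by (intro ennreal_leI mult_left_mono powr_mono2 add_left_mono divide_left_mono) auto
    finally show ?thesis .
  qed
  then show "\<exists>Q\<ge>0. \<forall>t\<ge>\<delta>. M (2 + \<beta>) (w t) \<le> ennreal Q"
    using F by (intro exI[of _ "?b \<delta>"]) auto
qed (use cib_solution_evolution[OF sol] C in auto)

text \<open>Property (P3) with \<open>\<rho>\<^sub>0 = M\<^sub>0\<close> and \<open>\<rho>\<^sub>1 = M\<^sub>1\<close> of the initial condition, which is possible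
unless \<open>M\<^sub>0 = 0\<close>; in that case the initial condition vanishes, and so does the solution because it
conserves mass.\<close>

lemma mass_conserving_solution_moment_bounded:
  assumes sol: "mass_conserving_solution a B \<infinity> win w" and P3: "P3 \<mu> win w"
    and win: "win \<in> Ypos 1" "win \<in> Y (1 + \<beta>)"
  shows "\<exists>C\<ge>0. \<forall>t\<ge>0. M (1 + \<beta>) (w t) \<le> ennreal C"
proof -
  have cib: "cib_solution a B \<infinity> win w" and M1: "\<And>t. t \<ge> 0 \<Longrightarrow> M 1 (w t) = M 1 win"
    using sol by (auto simp: mass_conserving_solution_def)
  have ev: "evolution w" and w0: "w 0 = win" using cib_solution_evolution[OF cib] by auto
  have nn: "win 0 = 0" "\<And>i. i \<ge> 1 \<Longrightarrow> 0 \<le> win i" "win \<in> Y 1" using win by (auto simp: Ypos_def Y_def)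
  have fin: "M 1 win < \<infinity>" "M (1 + \<beta>) win < \<infinity>"
    using in_Y_iff_moment_finite[of win] nn win by auto
  have "M 0 win \<le> M 1 win" using nn by (intro M0_le_M1) auto
  show ?thesis
  proof (cases "M 0 win = 0")
    case True
    have "M 1 win = 0"
    proof -
      have "win i = 0" for i
      proof (cases "i = 0")
        case False
        have "M 0 win \<le> ennreal 0" using True by simp
        then have "(\<Sum>j=1..i. real j powr 0 * win j) \<le> 0" using moment_le_iff[of win 0 0] nn by auto
        moreover have "real i powr 0 * win i \<le> (\<Sum>j=1..i. real j powr 0 * win j)"
          using False nn by (intro member_le_sum) auto
        ultimately show ?thesis using False nn(2)[of i] by auto
      qed (use nn in auto)
      then show ?thesis by (simp add: M_def)
    qed
    then have "M (1 + \<beta>) (w t) \<le> ennreal 0" if "t \<ge> 0" for t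
    proof -
      have w: "0 \<le> w t i" if "i \<ge> 1" for i using ev \<open>t \<ge> 0\<close> that by (rule evolution_nonneg)
      have "M 1 (w t) \<le> ennreal 0" using M1[OF that] \<open>M 1 win = 0\<close> by simp
      then have le: "(\<Sum>j=1..i. real j powr 1 * w t j) \<le> 0" for i using moment_le_iff[of "w t" 0 1] w by auto
      have "w t i = 0" if "i \<ge> 1" for i
      proof -
        have "real i powr 1 * w t i \<le> (\<Sum>j=1..i. real j powr 1 * w t j)"
          using that w by (intro member_le_sum) auto
        with le[of i] have "real i * w t i \<le> 0" using that by simp
        then show ?thesis using w[OF that] that by (simp add: mult_le_0_iff)
      qed
      then show ?thesis using moment_le_iff[of "w t" 0 "1 + \<beta>"] by auto
    qed
    then show ?thesis by (intro exI[of _ 0]) auto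
  next
    case False
    obtain r0 where r0: "M 0 win = ennreal r0" "r0 \<ge> 0"
      using \<open>M 0 win \<le> M 1 win\<close> fin(1) by (cases "M 0 win") (auto simp: top_unique)
    obtain r1 where r1: "M 1 win = ennreal r1" "r1 \<ge> 0" using fin(1) by (cases "M 1 win") auto
    obtain C where C: "M (1 + \<beta>) win = ennreal C" "C \<ge> 0" using fin(2) by (cases "M (1 + \<beta>) win") auto
    have r: "0 < r0" "r0 \<le> r1"
      using r0 r1 False \<open>M 0 win \<le> M 1 win\<close> ennreal_le_iff[of r1 r0] by (auto simp: order_less_le)
    let ?D = "max C (\<mu> (1 + \<beta>) r0 r1)"
    have le: "M (1 + \<beta>) (w t) \<le> max (M (1 + \<beta>) win) (ennreal (\<mu> (1 + \<beta>) r0 r1))" if "t > 0" for t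
      using P3[unfolded P3_def, rule_format, of "1 + \<beta>" r0 r1 t] \<beta>_pos r win that r0 r1 by simp
    have "M (1 + \<beta>) (w t) \<le> ennreal ?D" if "t \<ge> 0" for t
    proof (cases "t = 0")
      case False
      then have "M (1 + \<beta>) (w t) \<le> max (ennreal C) (ennreal (\<mu> (1 + \<beta>) r0 r1))" using le[of t] that C by simp
      also have "\<dots> \<le> ennreal ?D" by (intro max.boundedI ennreal_leI) auto
      finally show ?thesis .
    qed (use w0 C in \<open>auto intro: ennreal_leI\<close>)
    then show ?thesis using C by (intro exI[of _ ?D]) auto
  qed
qed

end

section \<open>The flow\<close>

locale moment_controlled_breakage = collision_breakage +
  fixes F :: "real \<Rightarrow> ennreal \<Rightarrow> ennreal \<Rightarrow> real" and \<mu> :: "real \<Rightarrow> real \<Rightarrow> real \<Rightarrow> real"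
  assumes constants: "moment_constants A \<alpha> \<beta> B F \<mu>"
begin

abbreviation "admissible_solution \<equiv> bounded_mc_solution A \<alpha> \<beta> B F \<mu>"

lemma F_pos: "win \<in> Ypos 1 \<Longrightarrow> 0 < F (2 + \<beta>) (M 1 win) (M 0 win)"
  using constants \<beta>_pos by (auto simp: moment_constants_def)

lemma admissible_solution_regular:
  assumes "admissible_solution win w" "win \<in> Ypos 1 \<inter> Y (1 + \<beta>)"
  shows "\<exists>C\<ge>0. regular_evolution C w"
proof -
  have sol: "mass_conserving_solution a B \<infinity> win w" "P2 \<beta> F win w" "P3 \<mu> win w"
    using assms by (auto simp: bounded_mc_solution_def)
  then obtain C where "C \<ge> 0" "\<And>t. t \<ge> 0 \<Longrightarrow> M (1 + \<beta>) (w t) \<le> ennreal C"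
    using mass_conserving_solution_moment_bounded assms(2) by blast
  then show ?thesis
    using solution_regular_evolution[of win w F C] sol F_pos assms(2) by (auto simp: mass_conserving_solution_def)
qed

lemma admissible_solution_initial: "admissible_solution win w \<Longrightarrow> w 0 = win"
  using cib_solution_evolution by (auto simp: bounded_mc_solution_def mass_conserving_solution_def)

lemma admissible_solution_unique:
  assumes "admissible_solution win w" "admissible_solution win z" "win \<in> Ypos 1 \<inter> Y (1 + \<beta>)" "t \<ge> 0"
  shows "w t = z t"
proof -
  obtain C where C: "C \<ge> 0" "regular_evolution C w" using admissible_solution_regular assms by blast
  obtain D where D: "D \<ge> 0" "regular_evolution D z" using admissible_solution_regular assms by blast
  show ?thesis
  proof (rule regular_evolution_unique)
    show "regular_evolution (max C D) w" "regular_evolution (max C D) z"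
      using C D by (auto intro: regular_evolution_mono)
  qed (use C assms admissible_solution_initial in auto)
qed

lemma admissible_solution_exists:
  assumes win: "win \<in> Ypos 1 \<inter> Y (1 + \<beta>)"
  shows "\<exists>w. admissible_solution win w"
proof -
  obtain w where sol: "mass_conserving_solution a B \<infinity> win w" and P: "P1 win w" "P2 \<beta> F win w" "P3 \<mu> win w"
    using constants win unfolding moment_constants_def by blast
  obtain C where C: "C \<ge> 0" "\<And>t. t \<ge> 0 \<Longrightarrow> M (1 + \<beta>) (w t) \<le> ennreal C"
    using mass_conserving_solution_moment_bounded[OF sol P(3)] win by blast
  have ev: "evolution w" using sol cib_solution_evolution by (auto simp: mass_conserving_solution_def)
  have in_Y: "w t \<in> Y (1 + \<beta>)" if "t > 0" for t
    using P(2) \<beta>_pos that by (auto simp: P2_def)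
  have "strongly_measurable_Y (1 + \<beta>) {0<..} w"
  proof (rule strongly_measurable_if_coordinates)
    show "(\<lambda>t. w t i) \<in> borel_measurable (lebesgue_on {0<..})" for i
      by (intro continuous_imp_measurable_on_sets_lebesgue evolution_continuous[OF ev]) auto
  qed (use in_Y in auto)
  moreover have "normY (1 + \<beta>) (w t) \<le> C" if "t > 0" for t
  proof (rule normY_le)
    fix n
    have w: "0 \<le> w t i" if "i \<ge> 1" for i using evolution_nonneg[OF ev] \<open>t > 0\<close> that by simp
    have "(\<Sum>i=1..n. real i powr (1 + \<beta>) * \<bar>w t i\<bar>) = (\<Sum>i=1..n. real i powr (1 + \<beta>) * w t i)"
      using w by (intro sum.cong) auto
    also have "\<dots> \<le> C" using moment_le_iff[of "w t" C "1 + \<beta>"] w C that by auto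
    finally show "(\<Sum>i=1..n. real i powr (1 + \<beta>) * \<bar>w t i\<bar>) \<le> C" .
  qed
  ultimately have "in_Linfty_Y (1 + \<beta>) {0<..} w"
    unfolding in_Linfty_Y_def using in_Y by (auto intro!: exI[of _ C] AE_I2 simp: space_restrict_space)
  then show ?thesis using sol P by (auto simp: bounded_mc_solution_def)
qed

definition flow :: "real \<Rightarrow> (nat \<Rightarrow> real) \<Rightarrow> nat \<Rightarrow> real" where
  "flow t win = (SOME w. admissible_solution win w) t"

lemma flow_admissible_solution:
  assumes "win \<in> Ypos 1 \<inter> Y (1 + \<beta>)"
  shows "admissible_solution win (\<lambda>t. flow t win)"
  using someI_ex[OF admissible_solution_exists[OF assms]] by (simp add: flow_def)

context
  fixes \<rho>0 \<rho>1 R :: real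
  assumes \<rho>: "0 < \<rho>0" "\<rho>0 \<le> \<rho>1" and R: "\<mu> (1 + \<beta>) \<rho>0 \<rho>1 \<le> R"
begin

lemma R_pos: "0 < R"
proof -
  have "0 < \<mu> (1 + \<beta>) \<rho>0 \<rho>1"
    using constants \<rho> \<beta>_pos by (simp add: moment_constants_def)
  then show ?thesis using R by simp
qed

lemma S_subset: "y \<in> S \<beta> \<rho>0 \<rho>1 R \<Longrightarrow> y \<in> Ypos 1 \<inter> Y (1 + \<beta>)"
  using in_Y_iff_moment_finite[of y "1 + \<beta>"] by (auto simp: S_def Ypos_def Y_def intro: le_less_trans)

text \<open>The number of particles does not fall below its initial value by (P1), the mass is conserved, and
(P3) keeps the moment of order \<open>1 + \<beta>\<close> below \<open>R\<close> because \<open>R\<close> is at least \<open>\<mu>\<close>.\<close>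

lemma flow_in_S:
  assumes y: "y \<in> S \<beta> \<rho>0 \<rho>1 R" and "t \<ge> 0"
  shows "flow t y \<in> S \<beta> \<rho>0 \<rho>1 R"
proof (cases "t = 0")
  case True
  then show ?thesis using admissible_solution_initial[OF flow_admissible_solution[OF S_subset[OF y]]] y by simp
next
  case False
  let ?w = "\<lambda>t. flow t y"
  have good: "admissible_solution y ?w" by (rule flow_admissible_solution[OF S_subset[OF y]])
  then have sol: "cib_solution a B \<infinity> y ?w" and P: "P1 y ?w" "P2 \<beta> F y ?w" "P3 \<mu> y ?w" and mass: "M 1 (?w t) = M 1 y"
    using \<open>t \<ge> 0\<close> by (auto simp: bounded_mc_solution_def mass_conserving_solution_def)
  have nn: "?w t 0 = 0" "\<And>i. i \<ge> 1 \<Longrightarrow> 0 \<le> ?w t i"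
    using cib_solution_evolution(1)[OF sol] \<open>t \<ge> 0\<close> by (auto simp: evolution_def)
  have "ennreal \<rho>0 \<le> M 0 y" using y by (simp add: S_def)
  also have "\<dots> \<le> M 0 (?w t)" using P(1) \<open>t \<ge> 0\<close> by (simp add: P1_def)
  finally have M0: "ennreal \<rho>0 \<le> M 0 (?w t)" .
  have M1: "M 1 (?w t) = ennreal \<rho>1" using mass y by (simp add: S_def)
  have "M (1 + \<beta>) (?w t) \<le> max (M (1 + \<beta>) y) (ennreal (\<mu> (1 + \<beta>) \<rho>0 \<rho>1))"
  proof -
    have "y \<in> Y (1 + \<beta>)" "M 1 y \<le> ennreal \<rho>1" "ennreal \<rho>0 \<le> M 0 y"
      using y S_subset[OF y] by (auto simp: S_def)
    then show ?thesis
      using P(3)[unfolded P3_def, rule_format, of "1 + \<beta>" \<rho>0 \<rho>1 t] \<beta>_pos \<rho> False \<open>t \<ge> 0\<close> by simp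
  qed
  also have "\<dots> \<le> ennreal R" using y R by (intro max.boundedI ennreal_leI) (auto simp: S_def)
  finally have "M (1 + \<beta>) (?w t) \<le> ennreal R" .
  moreover have "?w t \<in> Ypos 1"
    using in_Y_iff_moment_finite[of "?w t" 1] nn M1 by (auto simp: Ypos_def)
  ultimately show ?thesis
    using M0 M1 M0_le_M1[of "?w t"] nn by (auto simp: S_def)
qed

lemma flow_regular:
  assumes y: "y \<in> S \<beta> \<rho>0 \<rho>1 R"
  shows "regular_evolution R (\<lambda>t. flow t y)"
proof -
  have good: "admissible_solution y (\<lambda>t. flow t y)" by (rule flow_admissible_solution[OF S_subset[OF y]])
  show ?thesis
  proof (rule solution_regular_evolution[where F = F and win = y])
    show "cib_solution a B \<infinity> y (\<lambda>t. flow t y)" "P2 \<beta> F y (\<lambda>t. flow t y)"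
      using good by (auto simp: bounded_mc_solution_def mass_conserving_solution_def)
    show "0 < F (2 + \<beta>) (M 1 y) (M 0 y)" using S_subset[OF y] by (intro F_pos) auto
    show "M (1 + \<beta>) (flow t y) \<le> ennreal R" if "t \<ge> 0" for t
      using flow_in_S[OF y that] by (simp add: S_def)
  qed
qed

lemma flow_0: "y \<in> S \<beta> \<rho>0 \<rho>1 R \<Longrightarrow> flow 0 y = y"
  using admissible_solution_initial[OF flow_admissible_solution[OF S_subset]] by simp

text \<open>A solution observed from time \<open>s\<close> on may violate (P2) for its new initial condition, but it
keeps the moment bounds of a regular evolution, and uniqueness holds in that class.\<close>

lemma flow_add:
  assumes y: "y \<in> S \<beta> \<rho>0 \<rho>1 R" and "t \<ge> 0" "s \<ge> 0"
  shows "flow (t + s) y = flow t (flow s y)"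
proof -
  have S: "flow s y \<in> S \<beta> \<rho>0 \<rho>1 R" using y \<open>s \<ge> 0\<close> by (rule flow_in_S)
  show ?thesis
    by (rule regular_evolution_unique[OF regular_evolution_shift[OF flow_regular[OF y] \<open>s \<ge> 0\<close>] flow_regular[OF S]])
      (use R_pos flow_0[OF S] \<open>t \<ge> 0\<close> in auto)
qed

text \<open>Compare \<open>flow s z\<close> with \<open>flow s y\<close> by stability, whose constant is uniform for initial data in
\<open>S\<close> and times in a bounded interval, and \<open>flow s y\<close> with \<open>flow t y\<close> by continuity in time.\<close>

lemma flow_continuous:
  "continuous_map (prod_topology (top_of_set {0..}) (subtopology (topY 1) (S \<beta> \<rho>0 \<rho>1 R)))
     (subtopology (topY 1) (S \<beta> \<rho>0 \<rho>1 R)) (\<lambda>(t, y). flow t y)"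
proof -
  interpret Y1: Metric_space "Y 1" "distY 1" by (rule Metric_space_Y)
  let ?S = "S \<beta> \<rho>0 \<rho>1 R"
  let ?X = "prod_topology (top_of_set {0::real..}) (subtopology (topY 1) ?S)"
  have SY: "?S \<subseteq> Y 1" by (auto simp: S_def Ypos_def)
  have tX: "topspace ?X = {0::real..} \<times> ?S" using SY by (auto simp: topY_def)
  have "continuous_map ?X Y1.mtopology (\<lambda>(t, y). flow t y)"
    unfolding Y1.continuous_map_to_metric tX
  proof (intro ballI allI impI)
    fix x and \<epsilon> :: real assume "x \<in> {0::real..} \<times> ?S" and "0 < \<epsilon>"
    then obtain t y where x: "x = (t, y)" and "0 \<le> t" and y: "y \<in> ?S" by auto
    have "((\<lambda>s. distY 1 (flow s y) (flow t y)) \<longlongrightarrow> 0) (at t within {0..})"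
      using R_pos \<open>0 \<le> t\<close> by (intro regular_evolution_continuous_in_Y1[OF flow_regular[OF y]]) auto
    then have "\<forall>\<^sub>F s in at t within {0..}. distY 1 (flow s y) (flow t y) < \<epsilon> / 2"
      using \<open>0 < \<epsilon>\<close> by (intro order_tendstoD(2)) auto
    then obtain d where "d > 0" and d: "\<And>s. s \<ge> 0 \<Longrightarrow> s \<noteq> t \<Longrightarrow> dist s t < d \<Longrightarrow> distY 1 (flow s y) (flow t y) < \<epsilon> / 2"
      unfolding eventually_at by auto
    have d': "distY 1 (flow s y) (flow t y) < \<epsilon> / 2" if "s \<ge> 0" "dist s t < d" for s
      using d[of s] that \<open>0 < \<epsilon>\<close> by (cases "s = t") (auto simp: distY_def normY_def)
    \<comment> \<open>\<open>E\<close> bounds the stability constant at all times within distance \<open>d\<close> of \<open>t\<close>.\<close>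
    define E where "E = exp (4 * A * R * (t + d))"
    define r where "r = \<epsilon> / (2 * E)"
    have "E > 0" "r > 0" using \<open>0 < \<epsilon>\<close> by (auto simp: E_def r_def)
    let ?U = "({0..} \<inter> ball t d) \<times> (?S \<inter> Y1.mball y r)"
    have "openin (top_of_set {0..}) ({0..} \<inter> ball t d)" by (intro openin_open_Int) auto
    moreover have "openin (subtopology (topY 1) ?S) (?S \<inter> Y1.mball y r)"
      unfolding topY_def by (intro openin_subtopology_Int2 Y1.openin_mball)
    ultimately have "openin ?X ?U" by (simp only: openin_prod_Times_iff simp_thms)
    moreover have "(t, y) \<in> ?U" using \<open>0 \<le> t\<close> y \<open>d > 0\<close> \<open>r > 0\<close> SY by auto
    moreover have "flow s z \<in> Y1.mball (flow t y) \<epsilon>" if "(s, z) \<in> ?U" for s z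
    proof -
      have s: "s \<ge> 0" "dist s t < d" and z: "z \<in> ?S" "distY 1 y z < r"
        using that by (auto simp: dist_commute)
      have inY: "flow t y \<in> Y 1" "flow s y \<in> Y 1" "flow s z \<in> Y 1"
        using flow_in_S y z(1) s(1) \<open>0 \<le> t\<close> SY by blast+
      have "distY 1 (flow s y) (flow s z) \<le> exp (4 * A * R * s) * distY 1 (flow 0 y) (flow 0 z)"
        using R_pos s(1) by (intro regular_evolution_stability flow_regular y z) auto
      also have "\<dots> = exp (4 * A * R * s) * distY 1 y z" using flow_0 y z by simp
      also have "\<dots> \<le> E * distY 1 y z"
        unfolding E_def using s A_pos R_pos by (intro mult_right_mono distY_nonneg) (auto simp: dist_real_def)
      also have "\<dots> < E * r" using z(2) \<open>E > 0\<close> by (intro mult_strict_left_mono) auto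
      also have "\<dots> = \<epsilon> / 2" using \<open>E > 0\<close> by (simp add: r_def)
      finally have "distY 1 (flow s y) (flow s z) < \<epsilon> / 2" .
      moreover have "distY 1 (flow t y) (flow s y) < \<epsilon> / 2" using d'[OF s] by (simp add: distY_commute)
      moreover have "distY 1 (flow t y) (flow s z) \<le> distY 1 (flow t y) (flow s y) + distY 1 (flow s y) (flow s z)"
        by (intro distY_triangle inY)
      ultimately show ?thesis using inY by simp
    qed
    ultimately show "\<exists>U. openin ?X U \<and> x \<in> U \<and>
        (\<forall>z\<in>U. (case z of (t, y) \<Rightarrow> flow t y) \<in> Y1.mball (case x of (t, y) \<Rightarrow> flow t y) \<epsilon>)"
      unfolding x by (intro exI[of _ ?U] conjI ballI) auto
  qed
  then show ?thesis
    unfolding continuous_map_in_subtopology tX using flow_in_S by (auto simp: topY_def)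
qed

lemma flow_dynamical_system: "dynamical_system (subtopology (topY 1) (S \<beta> \<rho>0 \<rho>1 R)) flow"
  unfolding dynamical_system_def using flow_continuous flow_0 flow_add by auto

end

end

theorem theorem2p4:
  fixes A \<alpha> \<beta> :: real
    and B :: "nat \<Rightarrow> nat \<Rightarrow> nat \<Rightarrow> real"
    and F :: "real \<Rightarrow> ennreal \<Rightarrow> ennreal \<Rightarrow> real"
    and \<mu> :: "real \<Rightarrow> real \<Rightarrow> real \<Rightarrow> real"
  assumes "A > 0" and "\<alpha> \<le> \<beta>" and "\<beta> \<le> 1" and "\<beta> > 0" and "\<alpha> < 1"
    and "cond_B1 B" and "cond_B2 B" and "cond_B3 B"
    and "moment_constants A \<alpha> \<beta> B F \<mu>"
  shows "\<exists>\<Psi> :: real \<Rightarrow> (nat \<Rightarrow> real) \<Rightarrow> (nat \<Rightarrow> real).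
      (\<forall>win \<in> Ypos 1 \<inter> Y (1 + \<beta>).
         bounded_mc_solution A \<alpha> \<beta> B F \<mu> win (\<lambda>t. \<Psi> t win) \<and>
         (\<forall>w. bounded_mc_solution A \<alpha> \<beta> B F \<mu> win w \<longrightarrow> (\<forall>t\<ge>0. w t = \<Psi> t win))) \<and>
      (\<forall>\<rho>\<^sub>0 \<rho>\<^sub>1 R. 0 < \<rho>\<^sub>0 \<and> \<rho>\<^sub>0 \<le> \<rho>\<^sub>1 \<and> \<mu> (1 + \<beta>) \<rho>\<^sub>0 \<rho>\<^sub>1 \<le> R \<longrightarrow>
         dynamical_system (subtopology (topY 1) (S \<beta> \<rho>\<^sub>0 \<rho>\<^sub>1 R)) \<Psi>)"
proof -
  interpret moment_controlled_breakage A \<alpha> \<beta> B F \<mu>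
    using assms by unfold_locales
  show ?thesis
    using flow_admissible_solution admissible_solution_unique flow_dynamical_system
    by (intro exI[of _ flow]) blast
qed

end
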